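(* There is a deterministic algorithm running in $O(n^{2.5})$ time which, given an $n$-vertex graph $G$, either finds a triangle in $G$, or outputs $O(n^{3/2})$ instances of $3$-colored Triangle Detection, where each instance is an induced subgraph of $G$ on $O(\sqrt{n})$ vertices together with a proper $3$-coloring of it, such that every triangle of $G$ is present in exactly one of the output instances.
   Context: A triangle is a set of three pairwise adjacent vertices. A proper $3$-coloring assigns one of three colors to each vertex so that adjacent vertices receive different colors; $3$-colored Triangle Detection asks whether a graph given with a proper $3$-coloring contains a triangle. An induced subgraph of $G$ on vertex set $U$ has all edges of $G$ with both endpoints in $U$. *)

theory Defs
  imports Complex_Main "HOL-Library.Landau_Symbols"
begin

section \<open>Graphs, triangles and colorings\<close>

definition simple_graph :: "'a set \<Rightarrow> 'a set set \<Rightarrow> bool" where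
  "simple_graph V E \<longleftrightarrow> finite V \<and> (\<forall>e\<in>E. e \<subseteq> V \<and> card e = 2)"

definition triangle :: "'a set \<Rightarrow> 'a set set \<Rightarrow> 'a set \<Rightarrow> bool" where
  "triangle V E T \<longleftrightarrow>
     T \<subseteq> V \<and> card T = 3 \<and> (\<forall>u\<in>T. \<forall>v\<in>T. u \<noteq> v \<longrightarrow> {u, v} \<in> E)"

definition induced_edges :: "'a set set \<Rightarrow> 'a set \<Rightarrow> 'a set set" where
  "induced_edges E U = {e \<in> E. e \<subseteq> U}"

definition proper_3_coloring :: "'a set \<Rightarrow> 'a set set \<Rightarrow> ('a \<Rightarrow> nat) \<Rightarrow> bool" where
  "proper_3_coloring V E f \<longleftrightarrow>
     (\<forall>v\<in>V. f v < 3) \<and> (\<forall>u\<in>V. \<forall>v\<in>V. {u, v} \<in> E \<longrightarrow> f u \<noteq> f v)"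

section \<open>A word RAM\<close>

text \<open>
  Time is measured on a unit-cost word RAM whose words have \<open>w\<close> bits, given by structured
  programs. Registers are named by the program text, so a program only uses a fixed finite number
  of them; the memory is addressed indirectly through registers; the output is a write-only
  stream of words. There is no source of randomness.
\<close>

type_synonym reg = nat

datatype com =
    Skip
  | Const reg nat
  | Add reg reg reg
  | Sub reg reg reg
  | Mul reg reg reg
  | Load reg reg
  | Store reg reg
  | Emit reg
  | Seq com com
  | IfLess reg reg com com
  | WhileLess reg reg com

record state =
  regs :: "reg \<Rightarrow> nat"
  mem :: "nat \<Rightarrow> nat"
  out :: "nat list"

text \<open>
  \<open>exec w c s t s'\<close>: with word length \<open>w\<close>, program \<open>c\<close> started in state \<open>s\<close> halts in state \<open>s'\<close>
  after exactly \<open>t\<close> steps. Arithmetic is modulo \<open>2 ^ w\<close>. Every basic instruction and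
  every evaluation of a branch or loop condition is one step.
\<close>

inductive exec :: "nat \<Rightarrow> com \<Rightarrow> state \<Rightarrow> nat \<Rightarrow> state \<Rightarrow> bool" for w :: nat where
  Skip: "exec w Skip s 1 s"
| Const: "exec w (Const r k) s 1 (s\<lparr>regs := (regs s)(r := k mod 2 ^ w)\<rparr>)"
| Add: "exec w (Add r p q) s 1
          (s\<lparr>regs := (regs s)(r := (regs s p + regs s q) mod 2 ^ w)\<rparr>)"
| Sub: "exec w (Sub r p q) s 1
          (s\<lparr>regs := (regs s)(r := nat ((int (regs s p) - int (regs s q)) mod 2 ^ w))\<rparr>)"
| Mul: "exec w (Mul r p q) s 1
          (s\<lparr>regs := (regs s)(r := (regs s p * regs s q) mod 2 ^ w)\<rparr>)"
| Load: "exec w (Load r p) s 1 (s\<lparr>regs := (regs s)(r := mem s (regs s p))\<rparr>)"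
| Store: "exec w (Store p r) s 1 (s\<lparr>mem := (mem s)(regs s p := regs s r)\<rparr>)"
| Emit: "exec w (Emit r) s 1 (s\<lparr>out := out s @ [regs s r]\<rparr>)"
| Seq: "exec w c\<^sub>1 s t\<^sub>1 s' \<Longrightarrow> exec w c\<^sub>2 s' t\<^sub>2 s'' \<Longrightarrow> exec w (Seq c\<^sub>1 c\<^sub>2) s (t\<^sub>1 + t\<^sub>2) s''"
| IfTrue: "regs s p < regs s q \<Longrightarrow> exec w c\<^sub>1 s t s' \<Longrightarrow> exec w (IfLess p q c\<^sub>1 c\<^sub>2) s (1 + t) s'"
| IfFalse: "\<not> regs s p < regs s q \<Longrightarrow> exec w c\<^sub>2 s t s' \<Longrightarrow>
    exec w (IfLess p q c\<^sub>1 c\<^sub>2) s (1 + t) s'"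
| WhileFalse: "\<not> regs s p < regs s q \<Longrightarrow> exec w (WhileLess p q c) s 1 s"
| WhileTrue: "regs s p < regs s q \<Longrightarrow> exec w c s t\<^sub>1 s' \<Longrightarrow> exec w (WhileLess p q c) s' t\<^sub>2 s'' \<Longrightarrow>
    exec w (WhileLess p q c) s (1 + t\<^sub>1 + t\<^sub>2) s''"

lemma exec_deterministic:
  "exec w c s t s' \<Longrightarrow> exec w c s u s'' \<Longrightarrow> u = t \<and> s'' = s'"
proof (induction arbitrary: u s'' rule: exec.induct)
  case (Seq c\<^sub>1 s t\<^sub>1 s1 c\<^sub>2 t\<^sub>2 s2)
  from Seq.prems show ?case by cases (use Seq.IH in blast)
next
  case (IfTrue s p q c\<^sub>1 t s1 c\<^sub>2)
  from IfTrue.prems show ?case by cases (use IfTrue in blast)+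
next
  case (IfFalse s p q c\<^sub>2 t s1 c\<^sub>1)
  from IfFalse.prems show ?case by cases (use IfFalse in blast)+
next
  case (WhileFalse s p q c)
  from WhileFalse.prems show ?case by cases (use WhileFalse in auto)
next
  case (WhileTrue s p q c t\<^sub>1 s1 t\<^sub>2 s2)
  from WhileTrue.prems show ?case by cases (use WhileTrue in blast)+
qed (erule exec.cases; simp)+

section \<open>Input and output conventions\<close>

text \<open>
  The input graph has vertex set \<open>{..<n}\<close>. Register 0 holds \<open>n\<close>, and the memory cells from
  address 0 on hold the adjacency matrix in row-major order.
\<close>

definition init_state :: "nat \<Rightarrow> nat set set \<Rightarrow> state" where
  "init_state n E =
     \<lparr>regs = (\<lambda>_. 0)(0 := n),
      mem = (\<lambda>a. if a < n * n \<and> {a div n, a mod n} \<in> E then 1 else 0),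
      out = []\<rparr>"

text \<open>
  An instance of 3-colored Triangle Detection is a graph with a coloring. It is written
  out in full: the number of vertices, their names, their colors, and the adjacency matrix in
  row-major order. The order in which the vertices are listed is up to the algorithm.
\<close>

record inst =
  ivertices :: "nat list"
  iedges :: "nat set set"
  icolor :: "nat \<Rightarrow> nat"

definition encode_inst :: "inst \<Rightarrow> nat list" where
  "encode_inst I =
     (let vs = ivertices I in
      [length vs] @ vs @ map (icolor I) vs @
      concat (map (\<lambda>u. map (\<lambda>v. if {u, v} \<in> iedges I then 1 else 0) vs) vs))"

datatype answer = Triangle nat nat nat | Instances "inst list"

fun encode_answer :: "answer \<Rightarrow> nat list" where
  "encode_answer (Triangle x y z) = [0, x, y, z]"
| "encode_answer (Instances Is) = 1 # concat (map encode_inst Is)"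

definition colored_induced_inst :: "nat set \<Rightarrow> nat set set \<Rightarrow> inst \<Rightarrow> bool" where
  "colored_induced_inst V E I \<longleftrightarrow>
     distinct (ivertices I) \<and> set (ivertices I) \<subseteq> V \<and>
     iedges I = induced_edges E (set (ivertices I)) \<and>
     proper_3_coloring (set (ivertices I)) (iedges I) (icolor I)"

text \<open>
  \<open>k\<close> bounds the number of instances and \<open>m\<close> the number of vertices of each. The
  instances form a list, so a triangle must occur at exactly one position of it.
\<close>

fun correct_answer :: "nat set \<Rightarrow> nat set set \<Rightarrow> real \<Rightarrow> real \<Rightarrow> answer \<Rightarrow> bool" where
  "correct_answer V E k m (Triangle x y z) \<longleftrightarrow> triangle V E {x, y, z}"
| "correct_answer V E k m (Instances Is) \<longleftrightarrow>
     real (length Is) \<le> k \<and>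
     (\<forall>I\<in>set Is. colored_induced_inst V E I \<and> real (length (ivertices I)) \<le> m) \<and>
     (\<forall>T. triangle V E T \<longrightarrow>
        (\<exists>!i. i < length Is \<and> triangle (set (ivertices (Is ! i))) (iedges (Is ! i)) T))"

end

(*
  Let S be the square root of n, rounded up. While some vertex v has at least S uncolored
  neighbours, S of them are made a color class of their own: either two of them are adjacent,
  and v completes a triangle, or the class is independent. Afterwards every vertex has fewer
  than S uncolored neighbours. The remaining vertices are placed greedily in independent classes
  of at most S vertices, out of 2 S available ones: fewer than S classes are full, since n <= S^2,
  and fewer than S non-full classes meet the neighbourhood of a given vertex. Every triangle then
  has its corners in three distinct classes, so the O(S^3) triples of classes give the instances.

  Every loop of the program is a counting loop whose length is bounded a priori in terms of n
  and S. In particular the search goes on after a triangle has been found, which is only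
  recorded in a flag; this keeps termination and the running time independent of correctness.
*)
theory Submission
  imports Defs "HOL-Real_Asymp.Real_Asymp"
begin

section \<open>Weakest preconditions with time\<close>

text \<open>The overview counts the non-full classes around a vertex without saying why they are
  few. After phase 1 every class has exactly S members, so the neighbours of v that lie in no full
  class are just its uncolored ones, fewer than S. In phase 2 a vertex moves from uncolored into a
  class that is not full, and a class can only become full, so the number of such neighbours never
  grows. A non-full class that rejects v contains one of them, and different classes contain
  different ones. This is the purpose of phase 1: greedy placement alone could be blocked around
  vertices of large degree. The choice of S near sqrt n balances all costs at n^(5/2): phase 1
  compares each pair (v, u) with a buffer of fewer than S vertices, n^2 S in total; phase 2 tries 2
  S + 1 colors for each vertex by a pass over all vertices, again n^2 S; phase 3 gathers and prints
  O(S^3) instances at O(n + S^2) each.\<close>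

definition wp :: "nat \<Rightarrow> com \<Rightarrow> (nat \<Rightarrow> state \<Rightarrow> bool) \<Rightarrow> state \<Rightarrow> bool" where
  "wp w c Q s \<longleftrightarrow> (\<exists>t s'. exec w c s t s' \<and> Q t s')"

inductive_cases exec_elims:
  "exec w Skip s t s'" "exec w (Const r k) s t s'" "exec w (Add r p q) s t s'"
  "exec w (Sub r p q) s t s'" "exec w (Mul r p q) s t s'" "exec w (Load r p) s t s'"
  "exec w (Store p r) s t s'" "exec w (Emit r) s t s'"
inductive_cases exec_SeqE: "exec w (Seq c d) s t s'"
inductive_cases exec_IfE: "exec w (IfLess p q c d) s t s'"

lemma wp_conseq:
  assumes "wp w c Q s" and "\<And>t s'. Q t s' \<Longrightarrow> R t s'"
  shows "wp w c R s"
  using assms unfolding wp_def by blast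

lemma wp_basic [simp]:
  "wp w Skip Q s \<longleftrightarrow> Q 1 s"
  "wp w (Const r k) Q s \<longleftrightarrow> Q 1 (s\<lparr>regs := (regs s)(r := k mod 2 ^ w)\<rparr>)"
  "wp w (Add r p q) Q s \<longleftrightarrow> Q 1 (s\<lparr>regs := (regs s)(r := (regs s p + regs s q) mod 2 ^ w)\<rparr>)"
  "wp w (Mul r p q) Q s \<longleftrightarrow> Q 1 (s\<lparr>regs := (regs s)(r := (regs s p * regs s q) mod 2 ^ w)\<rparr>)"
  "wp w (Load r p) Q s \<longleftrightarrow> Q 1 (s\<lparr>regs := (regs s)(r := mem s (regs s p))\<rparr>)"
  "wp w (Store p r) Q s \<longleftrightarrow> Q 1 (s\<lparr>mem := (mem s)(regs s p := regs s r)\<rparr>)"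
  "wp w (Emit r) Q s \<longleftrightarrow> Q 1 (s\<lparr>out := out s @ [regs s r]\<rparr>)"
  unfolding wp_def by (force intro: exec.intros elim: exec_elims)+

text \<open>Elapsed time is an argument of the postcondition, so the cost of straight-line code
  falls out of rewriting. Bounds have to be supplied only for loops.\<close>

lemma wp_Seq [simp]: "wp w (Seq c d) Q s \<longleftrightarrow> wp w c (\<lambda>t. wp w d (\<lambda>u. Q (t + u))) s"
  unfolding wp_def by (blast intro: exec.Seq elim: exec_SeqE)

lemma wp_IfLess [simp]:
  "wp w (IfLess p q c d) Q s \<longleftrightarrow>
     (if regs s p < regs s q then wp w c (\<lambda>t. Q (1 + t)) s else wp w d (\<lambda>t. Q (1 + t)) s)"
  unfolding wp_def by (simp, metis exec.IfTrue exec.IfFalse exec_IfE plus_1_eq_Suc)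

section \<open>Syntactic footprints and counting loops\<close>

fun writes :: "com \<Rightarrow> reg set" where
  "writes (Const r k) = {r}"
| "writes (Add r p q) = {r}"
| "writes (Sub r p q) = {r}"
| "writes (Mul r p q) = {r}"
| "writes (Load r p) = {r}"
| "writes (Seq c d) = writes c \<union> writes d"
| "writes (IfLess p q c d) = writes c \<union> writes d"
| "writes (WhileLess p q c) = writes c"
| "writes _ = {}"

fun stores :: "com \<Rightarrow> bool" where
  "stores (Store p r) = True"
| "stores (Seq c d) = (stores c \<or> stores d)"
| "stores (IfLess p q c d) = (stores c \<or> stores d)"
| "stores (WhileLess p q c) = stores c"
| "stores _ = False"

fun emits :: "com \<Rightarrow> bool" where
  "emits (Emit r) = True"
| "emits (Seq c d) = (emits c \<or> emits d)"
| "emits (IfLess p q c d) = (emits c \<or> emits d)"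
| "emits (WhileLess p q c) = emits c"
| "emits _ = False"

text \<open>Keeps loop invariants short: whatever the program text cannot write is preserved without
  being mentioned in the invariant.\<close>

definition frame :: "com \<Rightarrow> state \<Rightarrow> state \<Rightarrow> bool" where
  "frame c s s' \<longleftrightarrow> (\<forall>r. r \<notin> writes c \<longrightarrow> regs s' r = regs s r) \<and>
     (\<not> stores c \<longrightarrow> mem s' = mem s) \<and> (\<not> emits c \<longrightarrow> out s' = out s)"

lemma exec_frame: "exec w c s t s' \<Longrightarrow> frame c s s'"
  unfolding frame_def by (induction rule: exec.induct) auto

definition For :: "reg \<Rightarrow> reg \<Rightarrow> com \<Rightarrow> com" where
  "For i q c = Seq (Const i 0) (WhileLess i q (Seq c (Add i i 2)))"

lemma For_simps [simp]:
  "writes (For i q c) = insert i (writes c)"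
  "stores (For i q c) = stores c"
  "emits (For i q c) = emits c"
  by (auto simp: For_def)

text \<open>Each round costs the body, a test and an increment, hence \<open>T + 2\<close>; the
  final \<open>2\<close> is the initialisation and the failing test. \<open>N < 2 ^ w\<close> keeps
  the counter from wrapping around, and \<open>indep\<close> carries the invariant across the
  increment that follows the body.\<close>

lemma wp_For:
  fixes Inv :: "nat \<Rightarrow> state \<Rightarrow> bool"
  assumes reg: "i \<notin> writes c" "q \<notin> writes c" "2 \<notin> writes c" "i \<noteq> q" "i \<noteq> 2"
    and one: "regs s 2 = 1" and N: "regs s q = N" "N < 2 ^ w"
    and init: "Inv 0 s"
    and indep: "\<And>k s' x. Inv k s' \<Longrightarrow> Inv k (s'\<lparr>regs := (regs s')(i := x)\<rparr>)"
    and step: "\<And>k s'. \<lbrakk>k < N; regs s' i = k; frame (For i q c) s s'; Inv k s'\<rbrakk> \<Longrightarrow>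
                 wp w c (\<lambda>t s''. t \<le> T \<and> Inv (Suc k) s'') s'"
  shows "wp w (For i q c) (\<lambda>t s'. t \<le> N * (T + 2) + 2 \<and> Inv N s' \<and> frame (For i q c) s s') s"
proof -
  let ?W = "WhileLess i q (Seq c (Add i i 2))"
  \<comment> \<open>Induction on the number \<open>d\<close> of rounds still to run, so that the
    counter stands at \<open>N - d\<close>.\<close>
  have loop: "\<exists>t s''. exec w ?W s' t s'' \<and> t \<le> d * (T + 2) + 1 \<and> Inv N s''"
    if "d \<le> N" "regs s' i = N - d" "frame (For i q c) s s'" "Inv (N - d) s'" for d s'
    using that
  proof (induction d arbitrary: s')
    case 0
    then have "regs s' q = N" using reg N by (auto simp: frame_def)
    with 0 show ?case by (auto intro!: exI exec.WhileFalse)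
  next
    case (Suc d)
    let ?k = "N - Suc d"
    have q: "regs s' q = N" using reg N Suc.prems by (auto simp: frame_def)
    have k: "?k < N" "Suc ?k = N - d" using Suc.prems(1) by auto
    from step[OF k(1) Suc.prems(2,3,4)] obtain t s1 where
      1: "exec w c s' t s1" "t \<le> T" "Inv (Suc ?k) s1"
      unfolding wp_def by blast
    have fr: "frame c s' s1" using 1(1) by (rule exec_frame)
    have ri: "regs s1 i = ?k" and r2: "regs s1 2 = 1"
      using fr Suc.prems(2,3) reg one by (auto simp: frame_def)
    let ?s2 = "s1\<lparr>regs := (regs s1)(i := N - d)\<rparr>"
    have "Suc ?k mod 2 ^ w = N - d"
      using k N(2) by simp
    then have ex2: "exec w (Seq c (Add i i 2)) s' (t + 1) ?s2"
      using exec.Seq[OF 1(1) exec.Add[of w i i 2 s1]] by (simp add: ri r2)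
    have fr2: "frame (For i q c) s ?s2"
      using fr Suc.prems(3) by (auto simp: frame_def)
    obtain t' s3 where 3: "exec w ?W ?s2 t' s3" "t' \<le> d * (T + 2) + 1" "Inv N s3"
      using Suc.IH[of ?s2] Suc.prems(1) fr2 indep[OF 1(3)] k(2) by auto
    have lt: "regs s' i < regs s' q" using q k Suc.prems(2) by simp
    have "exec w ?W s' (1 + (t + 1) + t') s3"
      by (rule exec.WhileTrue[OF lt ex2 3(1)])
    moreover have "1 + (t + 1) + t' \<le> Suc d * (T + 2) + 1"
      using 1(2) 3(2) by simp
    ultimately show ?case using 3(3) by blast
  qed
  let ?s0 = "s\<lparr>regs := (regs s)(i := 0)\<rparr>"
  have "frame (For i q c) s ?s0" by (auto simp: frame_def)
  then obtain t s' where 1: "exec w ?W ?s0 t s'" "t \<le> N * (T + 2) + 1" "Inv N s'"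
    using loop[of N ?s0] indep[OF init, of 0] by auto
  have "exec w (For i q c) s (1 + t) s'"
    unfolding For_def using exec.Seq[OF exec.Const[of w i 0 s]] 1(1) by simp
  then show ?thesis
    unfolding wp_def using 1 exec_frame by fastforce
qed


section \<open>The program\<close>

text \<open>
  Register 0 holds \<open>n\<close>, 2 the constant 1, 3 the class size \<open>S\<close>, 4 and 5 the start addresses
  \<open>n * n\<close> and \<open>n * n + n\<close> of the coloring and of a buffer of vertices, 7 the number
  \<open>2 * S + 1\<close> of colors, where color 0 means uncolored, and 8 is never written and stays 0. Register 9 flags a
  triangle, held in 10, 11 and 12. Register 13 is the next fresh color in phase 1, a flag
  for a neighbour in the class under test in phase 2 and the smallest color of the triple in
  phase 3; register 14 counts the entries of the buffer or of the class. Registers 15 to 17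
  and 22 are further loop variables.
\<close>

abbreviation (input) seq :: "com \<Rightarrow> com \<Rightarrow> com" (infixr ";;" 60) where
  "c ;; d \<equiv> Seq c d"

abbreviation (input) IfPos :: "reg \<Rightarrow> com \<Rightarrow> com \<Rightarrow> com" where
  "IfPos r c d \<equiv> IfLess 8 r c d"

text \<open>The repeated test in the first branch makes every outcome cost exactly two tests, so
  that \<open>wp_IfEq\<close> can be an equation with a single time.\<close>

definition IfEq :: "reg \<Rightarrow> reg \<Rightarrow> com \<Rightarrow> com \<Rightarrow> com" where
  "IfEq p q c d = IfLess p q (IfLess p q d d) (IfLess q p d c)"

lemma wp_IfEq [simp]:
  "wp w (IfEq p q c d) Q s \<longleftrightarrow>
     (if regs s p = regs s q then wp w c (\<lambda>t. Q (2 + t)) s else wp w d (\<lambda>t. Q (2 + t)) s)"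
  by (auto simp: IfEq_def)

lemma IfEq_simps [simp]:
  "writes (IfEq p q c d) = writes c \<union> writes d"
  "stores (IfEq p q c d) \<longleftrightarrow> stores c \<or> stores d"
  "emits (IfEq p q c d) \<longleftrightarrow> emits c \<or> emits d"
  by (auto simp: IfEq_def)

definition scan_body :: com where
  "scan_body =
     Add 20 5 17 ;; Load 20 20 ;; Mul 21 16 0 ;; Add 21 21 20 ;; Load 21 21 ;;
     IfPos 21 (Const 9 1 ;; Add 10 15 8 ;; Add 11 16 8 ;; Add 12 20 8) Skip"

definition flush_body :: com where
  "flush_body = Add 20 5 17 ;; Load 20 20 ;; Add 20 4 20 ;; Store 20 13"

definition push_body :: com where
  "push_body =
     Add 20 5 14 ;; Store 20 16 ;; Add 14 14 2 ;;
     IfLess 14 3 Skip (For 17 14 flush_body ;; Add 13 13 2 ;; Const 14 0)"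

definition step_body :: com where
  "step_body =
     Add 18 4 16 ;; Load 18 18 ;;
     IfPos 18 Skip
       (Mul 19 15 0 ;; Add 19 19 16 ;; Load 19 19 ;;
        IfPos 19
          (For 17 14 scan_body ;; push_body)
          Skip)"

definition phase1 :: com where
  "phase1 = For 15 0 (Const 14 0 ;; For 16 0 step_body)"

definition count_body :: com where
  "count_body =
     Add 19 4 17 ;; Load 19 19 ;;
     IfLess 19 16 Skip (IfLess 16 19 Skip
       (Add 14 14 2 ;; Mul 20 15 0 ;; Add 20 20 17 ;; Load 20 20 ;; IfPos 20 (Const 13 1) Skip))"

definition place_body :: com where
  "place_body =
     Add 18 4 15 ;; Load 18 18 ;;
     IfPos 18 Skip
       (Const 14 0 ;; Const 13 0 ;; For 17 0 count_body ;;
        IfLess 14 3 (IfPos 13 Skip (Add 18 4 15 ;; Store 18 16)) Skip)"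

definition phase2 :: com where
  "phase2 = For 15 0 (For 16 7 place_body)"

definition gather_body :: com where
  "gather_body =
     (let ins = Add 20 5 14 ;; Store 20 17 ;; Add 14 14 2 in
      Add 19 4 17 ;; Load 19 19 ;; IfEq 19 15 ins (IfEq 19 16 ins (IfEq 19 13 ins Skip)))"

definition name_body :: com where
  "name_body = Add 19 5 17 ;; Load 19 19 ;; Emit 19"

definition color_body :: com where
  "color_body =
     Add 19 5 17 ;; Load 19 19 ;; Add 19 4 19 ;; Load 19 19 ;;
     IfEq 19 15 (Emit 8) (IfEq 19 16 (Emit 2) (Emit 23))"

definition entry_body :: com where
  "entry_body = Add 20 5 22 ;; Load 20 20 ;; Add 20 19 20 ;; Load 20 20 ;; Emit 20"

definition row_body :: com where
  "row_body = Add 19 5 17 ;; Load 19 19 ;; Mul 19 19 0 ;; For 22 14 entry_body"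

definition print_body :: com where
  "print_body =
     Emit 14 ;; For 17 14 name_body ;; For 17 14 color_body ;; For 17 14 row_body"

definition instance_body :: com where
  "instance_body = Const 14 0 ;; For 17 0 gather_body ;; print_body"

text \<open>The strictly decreasing nesting visits every three-element set of colors once, which is
  what makes the instance of a triangle unique.\<close>

definition phase3 :: com where
  "phase3 = For 15 7 (For 16 15 (For 13 16 instance_body))"

definition root_body :: com where
  "root_body = Mul 20 3 3 ;; IfLess 20 0 (Add 3 3 2) Skip"

definition prog :: com where
  "prog =
     Const 2 1 ;; Mul 4 0 0 ;; For 15 0 root_body ;;
     Add 5 4 0 ;; Add 7 3 3 ;; Add 7 7 2 ;; Const 13 1 ;;
     phase1 ;; phase2 ;;
     IfPos 9 (Emit 8 ;; Emit 10 ;; Emit 11 ;; Emit 12) (Emit 2 ;; Const 23 2 ;; phase3)"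

section \<open>Square root, memory layout and elementary loops\<close>

lemma wp_root:
  assumes r: "regs s 0 = n" "regs s 2 = 1" "regs s 3 = 0" and w: "n * n + 10 * n + 10 < 2 ^ w"
  shows "wp w (For 15 0 root_body) (\<lambda>t s'. t \<le> n * (3 + 2) + 2 \<and>
     (regs s' 3 \<le> n \<and> (n \<le> regs s' 3 * regs s' 3 \<or> regs s' 3 = n) \<and>
      (regs s' 3 = 0 \<or> (regs s' 3 - 1) * (regs s' 3 - 1) < n)) \<and>
     frame (For 15 0 root_body) s s') s"
\<comment> \<open>After \<open>k\<close> rounds the candidate has either reached the square root or
  been incremented every time. The last conjunct says that the previous value was still too small;
  it later yields that S is at most sqrt n + 1.\<close>
proof (rule wp_For[where Inv = "\<lambda>k s'. regs s' 3 \<le> k \<and> (n \<le> regs s' 3 * regs s' 3 \<or> regs s' 3 = k) \<and>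
      (regs s' 3 = 0 \<or> (regs s' 3 - 1) * (regs s' 3 - 1) < n)"])
  fix k and s' :: state
  let ?r = "regs s' 3"
  assume k: "k < n" and fr: "frame (For 15 0 root_body) s s'"
    and I: "?r \<le> k \<and> (n \<le> ?r * ?r \<or> ?r = k) \<and> (?r = 0 \<or> (?r - 1) * (?r - 1) < n)"
  have "?r * ?r \<le> n * n" using I k by (intro mult_mono) auto
  then have "?r * ?r < 2 ^ w" "Suc ?r < 2 ^ w" using w I k by linarith+
  then show "wp w root_body (\<lambda>t s''. t \<le> 3 \<and> regs s'' 3 \<le> Suc k \<and>
      (n \<le> regs s'' 3 * regs s'' 3 \<or> regs s'' 3 = Suc k) \<and>
      (regs s'' 3 = 0 \<or> (regs s'' 3 - 1) * (regs s'' 3 - 1) < n)) s'"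
    using fr I r k by (auto simp: root_body_def frame_def)
qed (use r w in \<open>auto simp: root_body_def\<close>)

text \<open>Addresses are at most \<open>n * n + 2 * n\<close> and colors and color counters at most
  \<open>2 * n + 1\<close>, so \<open>word\<close> rules out any wrap-around. How close
  \<open>S\<close> is to sqrt n enters only through the final bounds on time, number and
  size.\<close>

locale ram =
  fixes w n S :: nat and E :: "nat set set"
  assumes graph: "simple_graph {..<n} E"
    and word: "n * n + 10 * n + 10 < 2 ^ w"
    and S_le: "S \<le> n" and S: "n \<le> S * S"
begin

text \<open>The whole memory as a function of a coloring and a buffer. The buffer part is unbounded,
  so every address is covered and each store of the program becomes a function update of
  \<open>col\<close> or \<open>buf\<close>.\<close>

definition M :: "(nat \<Rightarrow> nat) \<Rightarrow> (nat \<Rightarrow> nat) \<Rightarrow> nat \<Rightarrow> nat" where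
  "M col buf a =
     (if a < n * n then if {a div n, a mod n} \<in> E then 1 else 0
      else if a < n * n + n then col (a - n * n) else buf (a - (n * n + n)))"

lemma idx: "v < n \<Longrightarrow> u < n \<Longrightarrow> v * n + u < n * n" for u v :: nat
proof -
  assume "v < n" "u < n"
  then have "v * n + u < Suc v * n" by simp
  also have "\<dots> \<le> n * n" using \<open>v < n\<close> by (intro mult_le_mono1) auto
  finally show ?thesis .
qed

lemma M_adj [simp]: "v < n \<Longrightarrow> u < n \<Longrightarrow> M col buf (v * n + u) = (if {v, u} \<in> E then 1 else 0)"
  using idx[of v u] by (simp add: M_def)

lemma M_col [simp]: "u < n \<Longrightarrow> M col buf (n * n + u) = col u"
  by (simp add: M_def)

lemma M_buf [simp]: "M col buf (n * n + n + j) = buf j"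
  by (simp add: M_def)

lemma M_upd_col [simp]: "u < n \<Longrightarrow> (M col buf)(n * n + u := x) = M (col(u := x)) buf"
  by (auto simp: M_def fun_eq_iff)

lemma M_upd_buf [simp]: "(M col buf)(n * n + n + j := x) = M col (buf(j := x))"
  by (auto simp: M_def fun_eq_iff)

lemma word_less [simp]: "a \<le> n * n + 10 * n + 10 \<Longrightarrow> a < 2 ^ w"
  using word by linarith

lemma mod_word [simp]: "a \<le> n * n + 10 * n + 10 \<Longrightarrow> a mod 2 ^ w = a"
  by simp

lemma w_pos [simp]: "0 < w"
  using word by (cases w) auto

lemma idx_le [simp]:
  assumes "v < n"
  shows "v * n \<le> n * n + 10 * n + 10" "u < n \<Longrightarrow> v * n + u \<le> n * n + 10 * n + 10"
  using idx[OF assms, of u] mult_le_mono1[of v n n] assms by linarith+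

lemma edge: "{x, y} \<in> E \<Longrightarrow> x < n \<and> y < n \<and> x \<noteq> y"
  using graph unfolding simple_graph_def by (auto simp: card_2_iff doubleton_eq_iff)

lemma triangleI:
  "{x, y} \<in> E \<Longrightarrow> {x, z} \<in> E \<Longrightarrow> {y, z} \<in> E \<Longrightarrow> triangle {..<n} E {x, y, z}"
  using edge[of x y] edge[of x z] edge[of y z]
  by (auto simp: triangle_def insert_commute)

definition base :: "state \<Rightarrow> bool" where
  "base s \<longleftrightarrow> regs s 0 = n \<and> regs s 2 = 1 \<and> regs s 3 = S \<and> regs s 4 = n * n \<and>
     regs s 5 = n * n + n \<and> regs s 7 = 2 * S + 1 \<and> regs s 8 = 0"

lemma base_frame: "base s \<Longrightarrow> frame c s s' \<Longrightarrow> writes c \<inter> {0, 2, 3, 4, 5, 7, 8} = {} \<Longrightarrow> base s'"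
  unfolding base_def frame_def by auto

text \<open>Stable under further search: a later find overwrites registers 10 to 12, but again with
  a triangle.\<close>

definition flag_ok :: "state \<Rightarrow> bool" where
  "flag_ok s \<longleftrightarrow> (regs s 9 \<noteq> 0 \<longrightarrow> triangle {..<n} E {regs s 10, regs s 11, regs s 12})"

lemma wp_scan:
  assumes b: "base s" and m: "mem s = M col buf" and r: "regs s 14 = c" "regs s 15 = v" "regs s 16 = u"
    and c: "c \<le> n" and e: "{v, u} \<in> E" and buf: "\<And>j. j < c \<Longrightarrow> {v, buf j} \<in> E"
    and f: "flag_ok s"
  shows "wp w (For 17 14 scan_body) (\<lambda>t s'. t \<le> c * (10 + 2) + 2 \<and>
     (flag_ok s' \<and> (regs s' 9 = 0 \<longrightarrow> regs s 9 = 0 \<and> (\<forall>j<c. {u, buf j} \<notin> E))) \<and>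
     frame (For 17 14 scan_body) s s') s"
proof (rule wp_For)
  fix k s'
  assume k: "k < c" "regs s' 17 = k" and fr: "frame (For 17 14 scan_body) s s'"
    and I: "flag_ok s' \<and> (regs s' 9 = 0 \<longrightarrow> regs s 9 = 0 \<and> (\<forall>j<k. {u, buf j} \<notin> E))"
  note * = fr[unfolded frame_def scan_body_def, simplified]
  have u: "u < n" "buf k < n" using edge[OF e] edge[OF buf[OF k(1)]] by auto
  show "wp w scan_body (\<lambda>t s''. t \<le> 10 \<and> flag_ok s'' \<and>
      (regs s'' 9 = 0 \<longrightarrow> regs s 9 = 0 \<and> (\<forall>j<Suc k. {u, buf j} \<notin> E))) s'"
    using I * b m r k c u edge[OF e]
    by (simp add: scan_body_def base_def flag_ok_def less_Suc_eq triangleI[OF e buf[OF k(1)]] all_conj_distrib imp_disjL)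
qed (use assms in \<open>auto simp: scan_body_def flag_ok_def base_def\<close>)

lemma wp_flush:
  assumes b: "base s" and m: "mem s = M col buf" and r: "regs s 14 = c" "regs s 13 = i"
    and c: "c \<le> n" and buf: "\<And>j. j < c \<Longrightarrow> buf j < n"
  shows "wp w (For 17 14 flush_body) (\<lambda>t s'. t \<le> c * (4 + 2) + 2 \<and>
     mem s' = M (\<lambda>x. if x \<in> buf ` {..<c} then i else col x) buf \<and>
     frame (For 17 14 flush_body) s s') s"
proof (rule wp_For)
  fix k s'
  assume k: "k < c" "regs s' 17 = k" and fr: "frame (For 17 14 flush_body) s s'"
    and I: "mem s' = M (\<lambda>x. if x \<in> buf ` {..<k} then i else col x) buf"
  note * = fr[unfolded frame_def flush_body_def, simplified]
  have upd: "(\<lambda>x. if x \<in> buf ` {..<Suc k} then i else col x) =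
      (\<lambda>x. if x \<in> buf ` {..<k} then i else col x)(buf k := i)"
    by (auto simp: lessThan_Suc)
  show "wp w flush_body (\<lambda>t s''. t \<le> 4 \<and> 
     mem s'' = M (\<lambda>x. if x \<in> buf ` {..<Suc k} then i else col x) buf) s'"
    using I * b m r k c buf[OF k(1)]
    by (simp add: flush_body_def base_def upd)
qed (use assms in \<open>auto simp: flush_body_def base_def\<close>)


section \<open>Color classes inside neighbourhoods\<close>

definition cls :: "(nat \<Rightarrow> nat) \<Rightarrow> nat \<Rightarrow> nat set" where
  "cls col i = {x. x < n \<and> col x = i}"

definition indep :: "(nat \<Rightarrow> nat) \<Rightarrow> bool" where
  "indep col \<longleftrightarrow> (\<forall>x y. {x, y} \<in> E \<longrightarrow> col x = col y \<longrightarrow> col x = 0)"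

text \<open>\<open>b\<close> is the next fresh color and \<open>f\<close> the triangle flag. Only
  independence depends on the flag: the cardinalities bound the colors and have to survive a
  recorded triangle, because the loops continue.\<close>

definition inv1 :: "(nat \<Rightarrow> nat) \<Rightarrow> nat \<Rightarrow> nat \<Rightarrow> bool" where
  "inv1 col b f \<longleftrightarrow> 1 \<le> b \<and> (\<forall>x<n. col x < b) \<and> (\<forall>i. 1 \<le> i \<and> i < b \<longrightarrow> card (cls col i) = S) \<and>
     (f = 0 \<longrightarrow> indep col)"

definition unc :: "(nat \<Rightarrow> nat) \<Rightarrow> nat \<Rightarrow> nat \<Rightarrow> nat set" where
  "unc col v u = {x. x < u \<and> col x = 0 \<and> {v, x} \<in> E}"

text \<open>The buffer enumerates the uncolored neighbours of \<open>v\<close> seen so far.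
  \<open>c < S\<close> is strict because a full buffer is emptied at once, so at the end of the row
  it bounds the number of all uncolored neighbours.\<close>

definition buf_ok :: "(nat \<Rightarrow> nat) \<Rightarrow> (nat \<Rightarrow> nat) \<Rightarrow> nat \<Rightarrow> nat \<Rightarrow> nat \<Rightarrow> nat \<Rightarrow> bool" where
  "buf_ok col buf c v u f \<longleftrightarrow> c < S \<and> inj_on buf {..<c} \<and> buf ` {..<c} = unc col v u \<and>
     (f = 0 \<longrightarrow> (\<forall>i<c. \<forall>j<c. {buf i, buf j} \<notin> E))"

definition low :: "(nat \<Rightarrow> nat) \<Rightarrow> nat \<Rightarrow> bool" where
  "low col v \<longleftrightarrow> (\<forall>v'<v. card (unc col v' n) < S)"

lemma finite_cls [simp]: "finite (cls col i)" and finite_unc [simp]: "finite (unc col v u)"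
  by (simp_all add: cls_def unc_def)

text \<open>Classes of different colors are disjoint. Serves twice: for the number of colors spent
  in phase 1 and for the number of full classes in phase 2.\<close>

lemma classes_card:
  assumes "finite I" "\<And>i. i \<in> I \<Longrightarrow> card (cls col i) \<ge> S"
  shows "card I * S \<le> card (\<Union>i\<in>I. cls col i)"
proof -
  have "card I * S \<le> (\<Sum>i\<in>I. card (cls col i))"
    using sum_mono[of I "\<lambda>_. S" "\<lambda>i. card (cls col i)"] assms(2) by simp
  also have "\<dots> = card (\<Union>i\<in>I. cls col i)"
    using assms(1) by (intro card_UN_disjoint[symmetric]) (auto simp: cls_def)
  finally show ?thesis .
qed

text \<open>The \<open>b - 1\<close> disjoint classes of size \<open>S\<close> fit into at most
  \<open>S * S\<close> vertices; \<open>0 < n\<close> forces \<open>S\<close> to be positive, so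
  that \<open>S\<close> can be cancelled.\<close>

lemma inv1_bound:
  assumes "inv1 col b f" "0 < n"
  shows "b \<le> S + 1"
proof -
  have "card {1..<b} * S \<le> card (\<Union>i\<in>{1..<b}. cls col i)"
    using assms by (intro classes_card) (auto simp: inv1_def)
  also have "\<dots> \<le> card {..<n}" by (intro card_mono) (auto simp: cls_def)
  also have "\<dots> \<le> S * S" using S by simp
  finally show ?thesis using assms(2) S by (cases "S = 0") auto
qed

text \<open>Coloring further vertices only removes uncolored neighbours. Hence one visit per vertex
  suffices in phase 1.\<close>

lemma low_mono:
  assumes "low col v" "\<And>x. col' x = 0 \<Longrightarrow> col x = 0"
  shows "low col' v"
  unfolding low_def
proof (intro allI impI)
  fix v' assume "v' < v"
  then have "card (unc col v' n) < S" using assms by (simp add: low_def)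
  moreover have "card (unc col' v' n) \<le> card (unc col v' n)"
    using assms(2) by (intro card_mono) (auto simp: unc_def)
  ultimately show "card (unc col' v' n) < S" by simp
qed

text \<open>The new class takes only uncolored vertices, so older classes keep their members, and
  \<open>b\<close> exceeds every color in use, so the class of \<open>b\<close> is exactly
  \<open>B\<close>.\<close>

lemma inv1_flush:
  assumes i: "inv1 col b f" and B: "card B = S" "\<And>x. x \<in> B \<Longrightarrow> x < n \<and> col x = 0"
    and ind: "f = 0 \<Longrightarrow> (\<forall>x\<in>B. \<forall>y\<in>B. {x, y} \<notin> E)"
  shows "inv1 (\<lambda>x. if x \<in> B then b else col x) (Suc b) f"
proof -
  let ?c = "\<lambda>x. if x \<in> B then b else col x"
  have b: "cls ?c b = B" "\<And>i. 1 \<le> i \<Longrightarrow> i < b \<Longrightarrow> cls ?c i = cls col i"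
    using i B by (auto simp: cls_def inv1_def)
  have "indep ?c" if "f = 0"
    unfolding indep_def
  proof (intro allI impI)
    fix x y assume xy: "{x, y} \<in> E" "?c x = ?c y"
    have "x < n" "y < n" using edge[OF xy(1)] by auto
    then have "col x < b" "col y < b" using i by (auto simp: inv1_def)
    with xy ind[OF that] i that show "?c x = 0"
      by (auto simp: inv1_def indep_def split: if_splits)
  qed
  then show ?thesis using i b B(1) by (auto simp: inv1_def less_Suc_eq)
qed

text \<open>\<open>u\<close> is new because the buffer holds only smaller vertices, and the pairs
  involving \<open>u\<close> are those that the preceding scan has tested.\<close>

lemma buf_ok_push:
  assumes "buf_ok col buf c v u f" "{v, u} \<in> E" "col u = 0"
    "f' = 0 \<Longrightarrow> f = 0 \<and> (\<forall>j<c. {u, buf j} \<notin> E)"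
  shows "inj_on (buf(c := u)) {..<Suc c}" "(buf(c := u)) ` {..<Suc c} = unc col v (Suc u)"
    "f' = 0 \<Longrightarrow> \<forall>i<Suc c. \<forall>j<Suc c. {(buf(c := u)) i, (buf(c := u)) j} \<notin> E"
proof -
  have B: "buf ` {..<c} = unc col v u" "inj_on buf {..<c}" using assms by (auto simp: buf_ok_def)
  have nu: "u \<notin> buf ` {..<c}" unfolding B by (simp add: unc_def)
  have im: "(buf(c := u)) ` {..<Suc c} = insert u (buf ` {..<c})"
    by (auto simp: lessThan_Suc)
  show "(buf(c := u)) ` {..<Suc c} = unc col v (Suc u)"
    unfolding im B using assms by (auto simp: unc_def less_Suc_eq)
  show "inj_on (buf(c := u)) {..<Suc c}"
    using B(2) nu by (auto simp: inj_on_def less_Suc_eq)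
  assume "f' = 0"
  moreover have "{u} \<notin> E" using edge[of u u] by auto
  ultimately show "\<forall>i<Suc c. \<forall>j<Suc c. {(buf(c := u)) i, (buf(c := u)) j} \<notin> E"
    using assms by (auto simp: buf_ok_def less_Suc_eq insert_commute)
qed

section \<open>Execution of the first phase\<close>

definition at1 :: "nat \<Rightarrow> nat \<Rightarrow> state \<Rightarrow> bool" where
  "at1 v u s \<longleftrightarrow> base s \<and> out s = [] \<and> flag_ok s \<and>
     (\<exists>col buf. mem s = M col buf \<and> inv1 col (regs s 13) (regs s 9) \<and>
        buf_ok col buf (regs s 14) v u (regs s 9) \<and> low col v)"

lemma at1I:
  assumes "mem s = M col buf" "base s" "out s = []" "flag_ok s" "inv1 col (regs s 13) (regs s 9)"
    "buf_ok col buf (regs s 14) v u (regs s 9)" "low col v"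
  shows "at1 v u s"
  using assms unfolding at1_def by blast

lemma writes1 [simp]:
  "writes scan_body = {9, 10, 11, 12, 20, 21}" "\<not> stores scan_body" "\<not> emits scan_body"
  "writes flush_body = {20}" "stores flush_body" "\<not> emits flush_body"
  "writes step_body = {9, 10, 11, 12, 13, 14, 17, 18, 19, 20, 21}" "stores step_body" "\<not> emits step_body"
  by (auto simp: scan_body_def flush_body_def step_body_def push_body_def)

lemma wp_step:
  assumes a: "at1 v u s" and r: "regs s 15 = v" "regs s 16 = u" and v: "v < n" "u < n"
  shows "wp w step_body (\<lambda>t s'. t \<le> 18 * S + 30 \<and> at1 v (Suc u) s') s"
proof -
  obtain col buf where m: "mem s = M col buf" and i1: "inv1 col (regs s 13) (regs s 9)" and
      bo: "buf_ok col buf (regs s 14) v u (regs s 9)" and lo: "low col v"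
    using a unfolding at1_def by blast
  have b: "base s" and o: "out s = []" and f: "flag_ok s" using a by (auto simp: at1_def)
  note bs = b[unfolded base_def]
  show ?thesis
  proof (cases "col u = 0 \<and> {v, u} \<in> E")
    case False
    then have "unc col v (Suc u) = unc col v u" by (auto simp: unc_def less_Suc_eq)
    then have "at1 v (Suc u) (s\<lparr>regs := R\<rparr>)"
      if "\<And>r. r < 18 \<Longrightarrow> R r = regs s r" for R
      using that b o f m i1 lo bo by (intro at1I[of _ col buf]) (simp_all add: buf_ok_def base_def flag_ok_def)
    then show ?thesis
      using False bs m r v by (cases "col u = 0") (simp_all add: step_body_def)
  next
    case True
    \<comment> \<open>The color of \<open>u\<close> and its adjacency bit with \<open>v\<close>, as
      loaded for the two tests.\<close>
    let ?R = "(regs s)(18 := 0, 19 := 1)"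
    let ?s1 = "s\<lparr>regs := ?R\<rparr>"
    let ?c = "regs s 14" and ?b = "regs s 13"
    have c: "?c < S" "?c \<le> n" using bo S_le by (auto simp: buf_ok_def)
    have bb: "?b \<le> S + 1" using inv1_bound[OF i1] v by simp
    have bufu: "buf j \<in> unc col v u" if "j < ?c" for j using bo that by (auto simp: buf_ok_def)
    then have bufe: "{v, buf j} \<in> E" if "j < ?c" for j using that by (auto simp: unc_def)
    have scan: "wp w (For 17 14 scan_body) (\<lambda>t s'. t \<le> ?c * (10 + 2) + 2 \<and>
     (flag_ok s' \<and> (regs s' 9 = 0 \<longrightarrow> regs ?s1 9 = 0 \<and> (\<forall>j<?c. {u, buf j} \<notin> E))) \<and>
     frame (For 17 14 scan_body) ?s1 s') ?s1"
      using True b m r f c bufe by (intro wp_scan[where v = v and col = col]) (auto simp: base_def flag_ok_def)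
    let ?buf = "buf(?c := u)"
    have rest: "wp w push_body (\<lambda>t s''. t \<le> 6 * S + 10 \<and> at1 v (Suc u) s'') s'"
      if fl: "flag_ok s'" "regs s' 9 = 0 \<longrightarrow> regs s 9 = 0 \<and> (\<forall>j<?c. {u, buf j} \<notin> E)"
        and fr: "frame (For 17 14 scan_body) ?s1 s'" for s'
    proof -
      have b': "base s'" using base_frame[OF _ fr] b by (simp add: base_def)
      note fr' = fr[unfolded frame_def, simplified]
      note push = buf_ok_push[of col buf ?c v u "regs s 9" "regs s' 9", OF bo]
      have i1': "inv1 col ?b (regs s' 9)" using i1 fl by (auto simp: inv1_def)
      have upd: "(mem s')(regs s' 5 + ?c := u) = M col ?buf"
        using fr' m bs by simp
      let ?s2 = "s'\<lparr>mem := M col ?buf, regs := (regs s')(20 := regs s' 5 + ?c, 14 := Suc ?c)\<rparr>"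
      have b2: "base ?s2" using b' by (simp add: base_def)
      have f2: "flag_ok ?s2" using fl by (simp add: flag_ok_def)
      show ?thesis
      proof (cases "Suc ?c < S")
        case lt: True
        have "buf_ok col ?buf (Suc ?c) v (Suc u) (regs s' 9)"
          using push True fl lt by (simp add: buf_ok_def)
        then have "at1 v (Suc u) ?s2"
          using b2 f2 o fr' i1' lo by (auto simp: at1_def)
        then show ?thesis
          using lt b' fr' r c upd bs by (simp add: push_body_def base_def)
      next
        case ge: False
        then have cS: "Suc ?c = S" using c by simp
        have fl2: "wp w (For 17 14 flush_body) (\<lambda>t s'. t \<le> S * (4 + 2) + 2 \<and>
            mem s' = M (\<lambda>x. if x \<in> ?buf ` {..<S} then ?b else col x) ?buf \<and>
            frame (For 17 14 flush_body) ?s2 s') ?s2"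
        proof (rule wp_flush)
          fix j assume "j < S"
          then have "?buf j \<in> unc col v (Suc u)" using push(2) True fl cS by auto
          then show "?buf j < n" using v by (auto simp: unc_def)
        qed (use b2 S_le fr' cS in auto)
        let ?col = "\<lambda>x. if x \<in> unc col v (Suc u) then ?b else col x"
        have im: "?buf ` {..<S} = unc col v (Suc u)" using push(2) True fl cS by auto
        have inv: "inv1 ?col (Suc ?b) (regs s' 9)"
        proof (rule inv1_flush[OF i1'])
          show "card (unc col v (Suc u)) = S"
            using push(1) True fl cS card_image[of ?buf "{..<S}"] im by simp
          show "x < n \<and> col x = 0" if "x \<in> unc col v (Suc u)" for x
            using that v by (auto simp: unc_def)
          show "\<forall>x\<in>unc col v (Suc u). \<forall>y\<in>unc col v (Suc u). {x, y} \<notin> E" if "regs s' 9 = 0"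
            proof -
            have "\<forall>i<S. \<forall>j<S. {?buf i, ?buf j} \<notin> E"
              using push(3) True fl that unfolding cS by simp
            then show ?thesis unfolding im[symmetric] by blast
          qed
        qed
        have b0: "?b \<noteq> 0" using i1 by (auto simp: inv1_def)
        have fin: "at1 v (Suc u) (s3\<lparr>regs := (regs s3)(13 := Suc ?b, 14 := 0)\<rparr>)"
          if "mem s3 = M ?col ?buf" "frame (For 17 14 flush_body) ?s2 s3" for s3
        proof -
          have "base s3" by (rule base_frame[OF b2 that(2)]) simp
          moreover have "flag_ok s3" "out s3 = []" "regs s3 9 = regs s' 9"
            using that(2) f2 o fr' by (auto simp: frame_def flag_ok_def)
          \<comment> \<open>The flushed vertices carry the nonzero color \<open>?b\<close>, so the
            emptied buffer again enumerates the uncolored neighbours.\<close>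
          moreover have "unc ?col v (Suc u) = {}" using b0 by (auto simp: unc_def)
          moreover have "low ?col v" using lo by (rule low_mono) (use b0 in \<open>auto split: if_splits\<close>)
          ultimately show ?thesis
            using that(1) inv c
            by (intro at1I[of _ ?col ?buf]) (simp_all add: base_def flag_ok_def buf_ok_def)
        qed
        have "wp w (For 17 14 flush_body ;; Add 13 13 2 ;; Const 14 0)
           (\<lambda>t s''. t \<le> 6 * S + 4 \<and> at1 v (Suc u) s'') ?s2"
          apply simp
          apply (rule wp_conseq[OF fl2])
          subgoal for t s3
            using fin[of s3] base_frame[OF b2, of "For 17 14 flush_body" s3] bb S_le fr' unfolding im
            by (simp add: frame_def base_def)
          done
        then show ?thesis
          using ge b' fr' r c upd bs cS
          by (simp add: push_body_def base_def) (erule wp_conseq, simp)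
      qed
    qed
    have "wp w (For 17 14 scan_body) (\<lambda>t. wp w push_body
        (\<lambda>u' s''. 7 + (t + u') \<le> 18 * S + 30 \<and> at1 v (Suc u) s'')) ?s1"
      apply (rule wp_conseq[OF scan])
      subgoal for t s3
        using c by (intro wp_conseq[OF rest[of s3]]) auto
      done
    then show ?thesis
      using bs m r v True by (simp add: step_body_def)
  qed
qed


definition after1 :: "nat \<Rightarrow> state \<Rightarrow> bool" where
  "after1 v s \<longleftrightarrow> base s \<and> out s = [] \<and> flag_ok s \<and>
     (\<exists>col buf. mem s = M col buf \<and> inv1 col (regs s 13) (regs s 9) \<and> low col v)"

lemma wp_phase1:
  assumes "base s" "mem s = M (\<lambda>_. 0) (\<lambda>_. 0)" "out s = []" "regs s 9 = 0" "regs s 13 = 1"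
  shows "wp w phase1 (\<lambda>t s'. t \<le> n * ((n * ((18 * S + 30) + 2) + 3) + 2) + 2 \<and> after1 n s') s"
proof -
  have "wp w phase1 (\<lambda>t s'. t \<le> n * ((n * ((18 * S + 30) + 2) + 3) + 2) + 2 \<and> after1 n s' \<and>
      frame phase1 s s') s"
    unfolding phase1_def
  proof (rule wp_For[where Inv = after1])
    have "inv1 (\<lambda>_. 0) 1 0" by (auto simp: inv1_def indep_def)
    then show "after1 0 s" using assms by (auto simp: after1_def flag_ok_def low_def)
  next
    fix v s'
    assume v: "v < n" "regs s' 15 = v" and a: "after1 v s'"
    let ?s1 = "s'\<lparr>regs := (regs s')(14 := 0)\<rparr>"
    obtain col buf where m: "mem s' = M col buf" "inv1 col (regs s' 13) (regs s' 9)" "low col v"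
      using a by (auto simp: after1_def)
    have S0: "0 < S" using v S by (cases S) auto
    have "unc col v 0 = {}" by (auto simp: unc_def)
    then have a1: "at1 v 0 ?s1"
      using m a S0 by (intro at1I[of _ col buf]) (simp_all add: after1_def base_def flag_ok_def buf_ok_def)
    have "wp w (For 16 0 step_body) (\<lambda>t s''. t \<le> n * ((18 * S + 30) + 2) + 2 \<and> at1 v n s'' \<and>
        frame (For 16 0 step_body) ?s1 s'') ?s1"
    proof (rule wp_For[where Inv = "at1 v"])
      fix u s2 assume u: "u < n" "regs s2 16 = u" "frame (For 16 0 step_body) ?s1 s2" "at1 v u s2"
      then have "regs s2 15 = v" using v by (simp add: frame_def)
      then show "wp w step_body (\<lambda>t s''. t \<le> 18 * S + 30 \<and> at1 v (Suc u) s'') s2"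
        using u v by (intro wp_step)
    next
      fix k s2 x assume "at1 v k s2"
      then show "at1 v k (s2\<lparr>regs := (regs s2)(16 := x)\<rparr>)"
        by (simp add: at1_def base_def flag_ok_def)
    qed (use a a1 in \<open>simp_all add: after1_def base_def\<close>)
    \<comment> \<open>Vertices left in the buffer stay uncolored. They are all the uncolored
      neighbours of \<open>v\<close>, and fewer than \<open>S\<close>, which is what
      \<open>low\<close> demands of \<open>v\<close>.\<close>
    moreover have "after1 (Suc v) s2" if at: "at1 v n s2" for s2
    proof -
      obtain col buf where c: "mem s2 = M col buf" "inv1 col (regs s2 13) (regs s2 9)"
         "buf_ok col buf (regs s2 14) v n (regs s2 9)" "low col v"
        using at by (auto simp: at1_def)
      have "card (unc col v n) < S"
        using c(3) card_image[of buf "{..<regs s2 14}"] by (simp add: buf_ok_def)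
      then show ?thesis using at c by (auto simp: after1_def at1_def low_def less_Suc_eq)
    qed
    ultimately show "wp w (Const 14 0 ;; For 16 0 step_body)
        (\<lambda>t s''. t \<le> n * ((18 * S + 30) + 2) + 3 \<and> after1 (Suc v) s'') s'"
      by (auto elim!: wp_conseq)
  next
    fix k s2 x assume "after1 k s2"
    then show "after1 k (s2\<lparr>regs := (regs s2)(15 := x)\<rparr>)"
      by (simp add: after1_def base_def flag_ok_def)
  qed (use assms in \<open>simp_all add: base_def\<close>)
  then show ?thesis by (auto elim!: wp_conseq)
qed

section \<open>Greedy coloring with bounded classes\<close>

text \<open>The neighbours outside all full classes, the only ones through which a non-full class
  can reject \<open>v\<close>. Their number is the potential that never increases in phase
  2.\<close>

definition few :: "(nat \<Rightarrow> nat) \<Rightarrow> nat \<Rightarrow> nat set" where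
  "few col v = {x. x < n \<and> {v, x} \<in> E \<and> (col x = 0 \<or> card (cls col (col x)) < S)}"

definition inv2 :: "(nat \<Rightarrow> nat) \<Rightarrow> nat \<Rightarrow> bool" where
  "inv2 col f \<longleftrightarrow> (\<forall>x<n. col x \<le> 2 * S) \<and> (\<forall>i\<ge>1. card (cls col i) \<le> S) \<and>
     (\<forall>v<n. card (few col v) < S) \<and> (f = 0 \<longrightarrow> indep col)"

definition bad :: "(nat \<Rightarrow> nat) \<Rightarrow> nat \<Rightarrow> nat \<Rightarrow> bool" where
  "bad col v i \<longleftrightarrow> S \<le> card (cls col i) \<or> (\<exists>x<n. col x = i \<and> {v, x} \<in> E)"

lemma finite_few [simp]: "finite (few col v)"
  by (simp add: few_def)

text \<open>Every class of phase 1 is full, so \<open>few\<close> reduces to the uncolored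
  neighbours, which \<open>low\<close> counts.\<close>

lemma inv1_imp_inv2:
  assumes i: "inv1 col b f" and "low col n"
  shows "inv2 col f"
  unfolding inv2_def
proof (intro conjI allI impI)
  fix x assume "x < n"
  then show "col x \<le> 2 * S" using i inv1_bound[OF i] by (fastforce simp: inv1_def)
next
  fix j :: nat assume j: "1 \<le> j"
  show "card (cls col j) \<le> S"
  proof (cases "j < b")
    case False
    then have "cls col j = {}" using i by (auto simp: cls_def inv1_def)
    then show ?thesis by simp
  qed (use i j in \<open>auto simp: inv1_def\<close>)
next
  fix v assume v: "v < n"
  have "card (cls col (col x)) = S" if "x < n" "col x \<noteq> 0" for x
    using i that by (auto simp: inv1_def)
  then have "few col v = unc col v n" by (auto simp: few_def unc_def)
  then show "card (few col v) < S" using assms v by (simp add: low_def)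
qed (use i in \<open>auto simp: inv1_def\<close>)

text \<open>\<open>v\<close> was uncolored and thus already counted in \<open>few\<close> by its
  neighbours, and enlarging a class can only remove its members from \<open>few\<close>.\<close>

lemma inv2_place:
  assumes i: "inv2 col f" and v: "v < n" "col v = 0" and j: "j \<le> 2 * S" "\<not> bad col v j"
  shows "inv2 (col(v := j)) f"
proof (cases "j = 0")
  \<comment> \<open>Loop counters start at 0, so color 0 is tried as well; storing it leaves the
    uncolored \<open>v\<close> as it is.\<close>
  case True
  then show ?thesis using i v by (metis fun_upd_triv)
next
  case False
  let ?c = "col(v := j)"
  have cj: "cls ?c j = insert v (cls col j)" using v by (auto simp: cls_def)
  have ck: "cls ?c k = cls col k" if "k \<noteq> 0" "k \<noteq> j" for k using that v by (auto simp: cls_def)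
  have sub: "cls col k \<subseteq> cls ?c k" if "k \<noteq> 0" for k using that v by (auto simp: cls_def)
  show ?thesis
    unfolding inv2_def
  proof (intro conjI allI impI)
    fix k :: nat assume k: "1 \<le> k"
    have "card (insert v (cls col j)) \<le> Suc (card (cls col j))" by (simp add: card_insert_if)
    also have "\<dots> \<le> S" using j by (auto simp: bad_def)
    finally show "card (cls ?c k) \<le> S" using k cj ck[of k] i by (cases "k = j") (auto simp: inv2_def)
  next
    fix u assume u: "u < n"
    have "few ?c u \<subseteq> few col u"
    proof
      fix x assume x: "x \<in> few ?c u"
      show "x \<in> few col u"
      proof (cases "x = v \<or> col x = 0")
        case False
        then have "card (cls ?c (col x)) < S" using x by (auto simp: few_def)
        then have "card (cls col (col x)) < S"
          using card_mono[OF _ sub[of "col x"]] False by (auto intro: le_less_trans)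
        then show ?thesis using x by (auto simp: few_def)
      qed (use x v in \<open>auto simp: few_def\<close>)
    qed
    then have "card (few ?c u) \<le> card (few col u)" by (simp add: card_mono)
    also have "\<dots> < S" using i u by (auto simp: inv2_def)
    finally show "card (few ?c u) < S" .
  next
    assume "f = 0"
    then have "indep col" using i by (auto simp: inv2_def)
    moreover have "{v, x} \<notin> E" "{x, v} \<notin> E" if "?c x = j" for x
      using j edge[of v x] edge[of x v] that by (auto simp: bad_def insert_commute split: if_splits)
    moreover have "{v} \<notin> E" using edge[of v v] by auto
    ultimately show "indep ?c" by (auto simp: indep_def)
  qed (use i j in \<open>auto simp: inv2_def\<close>)
qed

lemma not_all_bad:
  assumes i: "inv2 col f" and v: "v < n" "col v = 0"
  shows "\<exists>j. 1 \<le> j \<and> j < 2 * S + 1 \<and> \<not> bad col v j"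
proof (rule ccontr)
  assume "\<not> ?thesis"
  then have bad: "bad col v j" if "j \<in> {1..2 * S}" for j using that by auto
  let ?F = "{j \<in> {1..2 * S}. S \<le> card (cls col j)}"
  let ?N = "{j \<in> {1..2 * S}. \<not> S \<le> card (cls col j)}"
  have "card ?F * S \<le> card (\<Union>j\<in>?F. cls col j)" by (rule classes_card) auto
  \<comment> \<open>\<open>v\<close> itself is uncolored and hence outside these classes; leaving it
    out makes the count strict.\<close>
  also have "\<dots> \<le> card ({..<n} - {v})" using v by (intro card_mono) (auto simp: cls_def)
  also have "\<dots> < S * S" using v S by simp
  finally have F: "card ?F < S" by simp
  \<comment> \<open>A bad class that is not full contains a neighbour of \<open>v\<close>, and this
    neighbour belongs to \<open>few col v\<close>.\<close>
  have "?N \<subseteq> col ` few col v" using bad by (fastforce simp: bad_def few_def)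
  then have "card ?N \<le> card (few col v)" by (rule surj_card_le[rotated]) simp
  also have "\<dots> < S" using i v by (auto simp: inv2_def)
  finally have "card ?F + card ?N < 2 * S" using F by simp
  moreover have "card ?F + card ?N = card (?F \<union> ?N)" by (intro card_Un_disjoint[symmetric]) auto
  moreover have "?F \<union> ?N = {1..2 * S}" by auto
  ultimately show False by simp
qed

section \<open>Execution of the greedy placement\<close>

lemma wp_count:
  assumes b: "base s" and m: "mem s = M col buf" and v: "v < n"
    and r: "regs s 14 = 0" "regs s 13 = 0" "regs s 15 = v" "regs s 16 = i"
  shows "wp w (For 17 0 count_body) (\<lambda>t s'. t \<le> n * (10 + 2) + 2 \<and>
     (regs s' 14 = card {x. x < n \<and> col x = i} \<and>
      (regs s' 13 = 0 \<longleftrightarrow> (\<forall>x<n. col x = i \<longrightarrow> {v, x} \<notin> E))) \<and>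
     frame (For 17 0 count_body) s s') s"
proof (rule wp_For)
  fix k s'
  assume k: "k < n" "regs s' 17 = k" and fr: "frame (For 17 0 count_body) s s'"
    and I: "regs s' 14 = card {x. x < k \<and> col x = i} \<and>
      (regs s' 13 = 0 \<longleftrightarrow> (\<forall>x<k. col x = i \<longrightarrow> {v, x} \<notin> E))"
  note * = fr[unfolded frame_def count_body_def, simplified]
  have "card {x. x < k \<and> col x = i} \<le> card {..<k}" by (intro card_mono) auto
  then have c: "card {x. x < k \<and> col x = i} \<le> n" using k by simp
  have "{x. x < Suc k \<and> col x = i} =
      (if col k = i then insert k {x. x < k \<and> col x = i} else {x. x < k \<and> col x = i})"
    by (auto simp: less_Suc_eq)
  then have upd: "card {x. x < Suc k \<and> col x = i} =
      (if col k = i then Suc (card {x. x < k \<and> col x = i}) else card {x. x < k \<and> col x = i})"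
    by simp
  have "i < col k \<or> col k < i \<or> col k = i" by auto
  then show "wp w count_body (\<lambda>t s''. t \<le> 10 \<and> regs s'' 14 = card {x. x < Suc k \<and> col x = i} \<and>
      (regs s'' 13 = 0 \<longleftrightarrow> (\<forall>x<Suc k. col x = i \<longrightarrow> {v, x} \<notin> E))) s'"
    using I * b m r k c v
    by (elim disjE) (simp_all add: count_body_def base_def upd All_less_Suc)
qed (use assms in \<open>simp_all add: count_body_def base_def\<close>)

text \<open>The loop over colors does not stop at a success, so the colors already tried are claimed
  to be bad only while \<open>v\<close> is still uncolored.\<close>

definition at2 :: "nat \<Rightarrow> nat \<Rightarrow> state \<Rightarrow> bool" where
  "at2 v i s \<longleftrightarrow> base s \<and> out s = [] \<and> flag_ok s \<and>
     (\<exists>col buf. mem s = M col buf \<and> inv2 col (regs s 9) \<and> (\<forall>v'<v. col v' \<noteq> 0) \<and>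
        (col v = 0 \<longrightarrow> (\<forall>j<i. 1 \<le> j \<longrightarrow> bad col v j)))"

lemma writes2 [simp]:
  "writes count_body = {13, 14, 19, 20}" "\<not> stores count_body" "\<not> emits count_body"
  "writes place_body = {13, 14, 17, 18, 19, 20}" "stores place_body" "\<not> emits place_body"
  by (auto simp: count_body_def place_body_def)

lemma wp_place:
  assumes a: "at2 v i s" and r: "regs s 15 = v" "regs s 16 = i" and v: "v < n" "i \<le> 2 * S"
  shows "wp w place_body (\<lambda>t s'. t \<le> 12 * n + 15 \<and> at2 v (Suc i) s') s"
proof -
  obtain col buf where m: "mem s = M col buf" and i2: "inv2 col (regs s 9)"
      and pre: "\<forall>v'<v. col v' \<noteq> 0"
      and bd: "col v = 0 \<longrightarrow> (\<forall>j<i. 1 \<le> j \<longrightarrow> bad col v j)"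
    using a unfolding at2_def by (elim conjE exE) (rule that)
  have b: "base s" and o: "out s = []" and f: "flag_ok s" using a by (auto simp: at2_def)
  note bs = b[unfolded base_def]
  have at2I: "at2 v (Suc i) s'" if "base s'" "out s' = []" "flag_ok s'" "mem s' = M col' buf"
      "regs s' 9 = regs s 9" "col' = col \<and> (col v = 0 \<longrightarrow> 1 \<le> i \<longrightarrow> bad col v i) \<or>
       col' = col(v := i) \<and> col v = 0 \<and> \<not> bad col v i" for s' col'
    using that(6)
  proof (elim disjE conjE)
    assume "col' = col" "col v = 0 \<longrightarrow> 1 \<le> i \<longrightarrow> bad col v i"
    then show ?thesis
      unfolding at2_def using that i2 pre bd by (intro conjI exI[of _ col] exI[of _ buf]) (auto simp: less_Suc_eq)
  next
    assume "col' = col(v := i)" "col v = 0" "\<not> bad col v i"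
    then show ?thesis
      unfolding at2_def using that inv2_place[OF i2, of v i] v pre bd
      by (intro conjI exI[of _ col'] exI[of _ buf]) (auto simp: less_Suc_eq)
  qed
  show ?thesis
  proof (cases "col v = 0")
    case False
    then show ?thesis
      using bs m r v o f by (simp add: place_body_def) (rule at2I[of _ col], simp_all add: base_def flag_ok_def)
  next
    case True
    let ?s1 = "s\<lparr>regs := (regs s)(18 := 0, 14 := 0, 13 := 0)\<rparr>"
    have cnt: "wp w (For 17 0 count_body) (\<lambda>t s'. t \<le> n * (10 + 2) + 2 \<and>
       (regs s' 14 = card {x. x < n \<and> col x = i} \<and>
        (regs s' 13 = 0 \<longleftrightarrow> (\<forall>x<n. col x = i \<longrightarrow> {v, x} \<notin> E))) \<and>
       frame (For 17 0 count_body) ?s1 s') ?s1"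
      by (rule wp_count) (use b m v r in \<open>simp_all add: base_def\<close>)
    have rest: "wp w (IfLess 14 3 (IfPos 13 Skip (Add 18 4 15 ;; Store 18 16)) Skip)
        (\<lambda>t s''. t \<le> 4 \<and> at2 v (Suc i) s'') s'"
      if c: "regs s' 14 = card {x. x < n \<and> col x = i}"
        "regs s' 13 = 0 \<longleftrightarrow> (\<forall>x<n. col x = i \<longrightarrow> {v, x} \<notin> E)"
        and fr: "frame (For 17 0 count_body) ?s1 s'" for s'
    proof -
      have bad_iff: "bad col v i \<longleftrightarrow> \<not> (regs s' 14 < S \<and> regs s' 13 = 0)"
        using c by (auto simp: bad_def cls_def)
      note fr' = fr[unfolded frame_def, simplified]
      have b': "base s'" using base_frame[OF _ fr] b by (simp add: base_def)
      have f': "flag_ok s'" "out s' = []" "regs s' 9 = regs s 9" "mem s' = M col buf"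
        using fr' f o m by (simp_all add: flag_ok_def)
      have "at2 v (Suc i) s'" if "bad col v i"
        using b' f' that by (intro at2I[of _ col]) simp_all
      moreover have "at2 v (Suc i) (s'\<lparr>regs := (regs s')(18 := n * n + v), mem := M (col(v := i)) buf\<rparr>)"
        if "\<not> bad col v i"
        using b' f' that True by (intro at2I[of _ "col(v := i)"]) (simp_all add: base_def flag_ok_def)
      ultimately show ?thesis
        using b' f' bad_iff fr' r v by (simp add: base_def) 
    qed
    have "wp w (For 17 0 count_body) (\<lambda>t. wp w (IfLess 14 3 (IfPos 13 Skip (Add 18 4 15 ;; Store 18 16)) Skip)
        (\<lambda>u s''. 5 + (t + u) \<le> 12 * n + 15 \<and> at2 v (Suc i) s'')) ?s1"
      apply (rule wp_conseq[OF cnt])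
      subgoal for t s' by (rule wp_conseq[OF rest[of s']]) simp_all
      done
    then show ?thesis
      using bs m r v True by (simp add: place_body_def)
  qed
qed

definition after2 :: "nat \<Rightarrow> state \<Rightarrow> bool" where
  "after2 v s \<longleftrightarrow> base s \<and> out s = [] \<and> flag_ok s \<and>
     (\<exists>col buf. mem s = M col buf \<and> inv2 col (regs s 9) \<and> (\<forall>v'<v. col v' \<noteq> 0))"

lemma wp_phase2:
  assumes "after1 n s"
  shows "wp w phase2
    (\<lambda>t s'. t \<le> n * (((2 * S + 1) * ((12 * n + 15) + 2) + 2) + 2) + 2 \<and> after2 n s') s"
proof -
  have "wp w phase2 (\<lambda>t s'. t \<le> n * (((2 * S + 1) * ((12 * n + 15) + 2) + 2) + 2) + 2 \<and> after2 n s' \<and>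
      frame phase2 s s') s"
    unfolding phase2_def
  proof (rule wp_For[where Inv = after2])
    show "after2 0 s" using assms inv1_imp_inv2 by (auto simp: after1_def after2_def)
  next
    fix v s'
    assume v: "v < n" "regs s' 15 = v" and a: "after2 v s'"
    have "wp w (For 16 7 place_body) (\<lambda>t s''. t \<le> (2 * S + 1) * ((12 * n + 15) + 2) + 2 \<and>
        at2 v (2 * S + 1) s'' \<and> frame (For 16 7 place_body) s' s'') s'"
    proof (rule wp_For[where Inv = "at2 v"])
      fix i s2
      assume u: "i < 2 * S + 1" "regs s2 16 = i" "frame (For 16 7 place_body) s' s2" "at2 v i s2"
      then have "regs s2 15 = v" using v by (simp add: frame_def)
      then show "wp w place_body (\<lambda>t s''. t \<le> 12 * n + 15 \<and> at2 v (Suc i) s'') s2"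
        using u v by (intro wp_place) auto
    next
      fix k s2 x assume "at2 v k s2"
      then show "at2 v k (s2\<lparr>regs := (regs s2)(16 := x)\<rparr>)"
        by (simp add: at2_def base_def flag_ok_def)
    qed (use a S_le in \<open>simp_all add: after2_def base_def at2_def\<close>)
    moreover have "after2 (Suc v) s2" if at: "at2 v (2 * S + 1) s2" for s2
    proof -
      obtain col buf where c: "mem s2 = M col buf" "inv2 col (regs s2 9)" "\<forall>v'<v. col v' \<noteq> 0"
         "col v = 0 \<longrightarrow> (\<forall>j<2 * S + 1. 1 \<le> j \<longrightarrow> bad col v j)"
        using at unfolding at2_def by (elim conjE exE) (rule that)
      have "col v \<noteq> 0" using not_all_bad[OF c(2) v(1)] c(4) by blast
      then show ?thesis using at c unfolding after2_def at2_def less_Suc_eq by blast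
    qed
    ultimately show "wp w (For 16 7 place_body)
        (\<lambda>t s''. t \<le> (2 * S + 1) * ((12 * n + 15) + 2) + 2 \<and> after2 (Suc v) s'') s'"
      by (auto elim!: wp_conseq)
  next
    fix k s2 x assume "after2 k s2"
    then show "after2 k (s2\<lparr>regs := (regs s2)(15 := x)\<rparr>)"
      by (simp add: after2_def base_def flag_ok_def)
  qed (use assms in \<open>simp_all add: after1_def base_def\<close>)
  then show ?thesis by (auto elim!: wp_conseq)
qed


section \<open>Triples of color classes\<close>

definition verts :: "(nat \<Rightarrow> nat) \<Rightarrow> nat \<Rightarrow> nat \<Rightarrow> nat \<Rightarrow> nat list" where
  "verts col i j k = filter (\<lambda>u. col u = i \<or> col u = j \<or> col u = k) [0..<n]"

definition tricolor :: "(nat \<Rightarrow> nat) \<Rightarrow> nat \<Rightarrow> nat \<Rightarrow> nat \<Rightarrow> nat" where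
  "tricolor col i j u = (if col u = i then 0 else if col u = j then 1 else 2)"

definition inst3 :: "(nat \<Rightarrow> nat) \<Rightarrow> nat \<Rightarrow> nat \<Rightarrow> nat \<Rightarrow> inst" where
  "inst3 col i j k = \<lparr>ivertices = verts col i j k,
     iedges = induced_edges E (set (verts col i j k)), icolor = tricolor col i j\<rparr>"

text \<open>With all vertices colored, class 0 is empty. The size bound can therefore range over all
  \<open>i\<close>, and triples with color 0 need no exception.\<close>

definition good :: "(nat \<Rightarrow> nat) \<Rightarrow> bool" where
  "good col \<longleftrightarrow> (\<forall>x<n. 1 \<le> col x \<and> col x \<le> 2 * S) \<and> (\<forall>i. card (cls col i) \<le> S) \<and> indep col"

lemma inv2_imp_good:
  assumes "inv2 col 0" "\<forall>v<n. col v \<noteq> 0"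
  shows "good col"
proof -
  have "cls col 0 = {}" using assms by (auto simp: cls_def)
  then have "card (cls col i) \<le> S" for i using assms by (cases "i = 0") (auto simp: inv2_def)
  then show ?thesis using assms by (auto simp: good_def inv2_def Suc_le_eq)
qed

section \<open>Writing out one instance\<close>

lemma wp_gather:
  assumes b: "base s" and m: "mem s = M col buf"
    and r: "regs s 14 = 0" "regs s 15 = i" "regs s 16 = j" "regs s 13 = k"
  shows "wp w (For 17 0 gather_body) (\<lambda>t s'. t \<le> n * (11 + 2) + 2 \<and>
     (\<exists>buf'. mem s' = M col buf' \<and> map buf' [0..<regs s' 14] = verts col i j k) \<and>
     frame (For 17 0 gather_body) s s') s"
  unfolding verts_def
proof (rule wp_For[where Inv = "\<lambda>u s'. \<exists>buf'. mem s' = M col buf' \<and>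
    map buf' [0..<regs s' 14] = filter (\<lambda>u. col u = i \<or> col u = j \<or> col u = k) [0..<u]"])
  let ?P = "\<lambda>u. col u = i \<or> col u = j \<or> col u = k"
  fix u s'
  assume k: "u < n" "regs s' 17 = u" and fr: "frame (For 17 0 gather_body) s s'"
    and I: "\<exists>buf'. mem s' = M col buf' \<and> map buf' [0..<regs s' 14] = filter ?P [0..<u]"
  from I obtain buf' where m': "mem s' = M col buf'" and
    eq: "map buf' [0..<regs s' 14] = filter ?P [0..<u]" by blast
  note * = fr[unfolded frame_def gather_body_def Let_def, simplified]
  have "regs s' 14 = length (filter ?P [0..<u])" using arg_cong[OF eq, of length] by simp
  also have "\<dots> \<le> u" using length_filter_le[of ?P "[0..<u]"] by simp
  finally have c: "regs s' 14 \<le> n" using k by simp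
  have eq2: "map (buf'(regs s' 14 := u)) [0..<Suc (regs s' 14)] = filter ?P [0..<Suc u]" if "?P u"
    using that eq by simp
  have eq3: "map buf' [0..<regs s' 14] = filter ?P [0..<Suc u]" if "\<not> ?P u"
    using that eq by simp
  have ex: "\<exists>buf''. M col (buf'(regs s' 14 := u)) = M col buf'' \<and>
      map buf'' [0..<Suc (regs s' 14)] = filter ?P [0..<Suc u]" if "?P u"
    using eq2[OF that] by blast
  show "wp w gather_body (\<lambda>t s''. t \<le> 11 \<and>
     (\<exists>buf'. mem s'' = M col buf' \<and> map buf' [0..<regs s'' 14] = filter ?P [0..<Suc u])) s'"
  proof (cases "?P u")
    case True
    then show ?thesis
      using * b r k c m' ex[OF True]
      by (auto simp: gather_body_def base_def Let_def simp del: upt_Suc filter.simps)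
  next
    case False
    then show ?thesis
      using * b r k c m' eq3[OF False]
      by (auto simp: gather_body_def base_def Let_def simp del: upt_Suc filter.simps)
  qed
qed (use assms in \<open>auto simp: gather_body_def base_def Let_def\<close>)

lemma wp_names:
  assumes b: "base s" and m: "mem s = M col buf" and r: "regs s 14 = m" and n: "m \<le> n"
  shows "wp w (For 17 14 name_body) (\<lambda>t s'. t \<le> m * (3 + 2) + 2 \<and>
     out s' = out s @ map buf [0..<m] \<and> frame (For 17 14 name_body) s s') s"
proof (rule wp_For)
  fix k s'
  assume k: "k < m" "regs s' 17 = k" and fr: "frame (For 17 14 name_body) s s'"
    and I: "out s' = out s @ map buf [0..<k]"
  note * = fr[unfolded frame_def name_body_def, simplified]
  show "wp w name_body (\<lambda>t s''. t \<le> 3 \<and> out s'' = out s @ map buf [0..<Suc k]) s'"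
    using I * assms k by (simp add: name_body_def base_def)
qed (use assms in \<open>simp_all add: name_body_def base_def\<close>)

lemma wp_colors:
  assumes b: "base s" and m: "mem s = M col buf"
    and r: "regs s 14 = m" "regs s 15 = i" "regs s 16 = j" "regs s 23 = 2" and n: "m \<le> n"
    and buf: "\<And>a. a < m \<Longrightarrow> buf a < n"
  shows "wp w (For 17 14 color_body) (\<lambda>t s'. t \<le> m * (9 + 2) + 2 \<and>
     out s' = out s @ map (\<lambda>a. tricolor col i j (buf a)) [0..<m] \<and>
     frame (For 17 14 color_body) s s') s"
proof (rule wp_For)
  fix k s'
  assume k: "k < m" "regs s' 17 = k" and fr: "frame (For 17 14 color_body) s s'"
    and I: "out s' = out s @ map (\<lambda>a. tricolor col i j (buf a)) [0..<k]"
  note * = fr[unfolded frame_def color_body_def, simplified]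
  show "wp w color_body (\<lambda>t s''. t \<le> 9 \<and>
      out s'' = out s @ map (\<lambda>a. tricolor col i j (buf a)) [0..<Suc k]) s'"
    using I * b m r n k buf[OF k(1)] by (simp add: color_body_def base_def tricolor_def)
qed (use assms in \<open>simp_all add: color_body_def base_def\<close>)

abbreviation bit :: "nat \<Rightarrow> nat \<Rightarrow> nat" where
  "bit x y \<equiv> if {x, y} \<in> E then 1 else 0"

lemma wp_entries:
  assumes b: "base s" and m: "mem s = M col buf"
    and r: "regs s 14 = m" "regs s 19 = x * n" "x < n" and n: "m \<le> n"
    and buf: "\<And>a. a < m \<Longrightarrow> buf a < n"
  shows "wp w (For 22 14 entry_body) (\<lambda>t s'. t \<le> m * (5 + 2) + 2 \<and>
     out s' = out s @ map (\<lambda>a. bit x (buf a)) [0..<m] \<and>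
     frame (For 22 14 entry_body) s s') s"
proof (rule wp_For)
  fix k s'
  assume k: "k < m" "regs s' 22 = k" and fr: "frame (For 22 14 entry_body) s s'"
    and I: "out s' = out s @ map (\<lambda>a. bit x (buf a)) [0..<k]"
  note * = fr[unfolded frame_def entry_body_def, simplified]
  show "wp w entry_body (\<lambda>t s''. t \<le> 5 \<and>
      out s'' = out s @ map (\<lambda>a. bit x (buf a)) [0..<Suc k]) s'"
    using I * b m r n k buf[OF k(1)] by (simp add: entry_body_def base_def)
qed (use assms in \<open>simp_all add: entry_body_def base_def\<close>)

lemma writes3 [simp]:
  "writes gather_body = {14, 19, 20}" "stores gather_body" "\<not> emits gather_body"
  "writes name_body = {19}" "\<not> stores name_body" "emits name_body"
  "writes color_body = {19}" "\<not> stores color_body" "emits color_body"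
  "writes entry_body = {20}" "\<not> stores entry_body" "emits entry_body"
  "writes row_body = {19, 20, 22}" "\<not> stores row_body" "emits row_body"
  "writes instance_body = {14, 17, 19, 20, 22}" "stores instance_body" "emits instance_body"
  by (auto simp: gather_body_def name_body_def color_body_def entry_body_def row_body_def
      print_body_def instance_body_def Let_def)

lemma wp_rows:
  assumes b: "base s" and m: "mem s = M col buf" and r: "regs s 14 = m" and n: "m \<le> n"
    and buf: "\<And>a. a < m \<Longrightarrow> buf a < n"
  shows "wp w (For 17 14 row_body) (\<lambda>t s'. t \<le> m * ((m * (5 + 2) + 5) + 2) + 2 \<and>
     out s' = out s @ concat (map (\<lambda>a. map (\<lambda>b. bit (buf a) (buf b)) [0..<m]) [0..<m]) \<and>
     frame (For 17 14 row_body) s s') s"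
proof (rule wp_For[where Inv = "\<lambda>k s'. out s' = out s @
    concat (map (\<lambda>a. map (\<lambda>b. bit (buf a) (buf b)) [0..<m]) [0..<k])"])
  fix k s'
  assume k: "k < m" "regs s' 17 = k" and fr: "frame (For 17 14 row_body) s s'"
    and I: "out s' = out s @ concat (map (\<lambda>a. map (\<lambda>b. bit (buf a) (buf b)) [0..<m]) [0..<k])"
  note * = fr[unfolded frame_def, simplified]
  let ?s1 = "s'\<lparr>regs := (regs s')(19 := buf k * n)\<rparr>"
  have b': "base ?s1" using b * by (simp add: base_def)
  have "wp w (For 22 14 entry_body) (\<lambda>t s''. t \<le> m * (5 + 2) + 2 \<and>
     out s'' = out ?s1 @ map (\<lambda>a. bit (buf k) (buf a)) [0..<m] \<and>
     frame (For 22 14 entry_body) ?s1 s'') ?s1"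
    by (rule wp_entries[OF b']) (use * m r n buf k in simp_all)
  then have "wp w (For 22 14 entry_body) (\<lambda>t s''. 3 + t \<le> m * (5 + 2) + 5 \<and>
     out s'' = out s @ concat (map (\<lambda>a. map (\<lambda>b. bit (buf a) (buf b)) [0..<m]) [0..<Suc k])) ?s1"
    by (rule wp_conseq) (simp add: I)
  then show "wp w row_body (\<lambda>t s''. t \<le> m * (5 + 2) + 5 \<and>
     out s'' = out s @ concat (map (\<lambda>a. map (\<lambda>b. bit (buf a) (buf b)) [0..<m]) [0..<Suc k])) s'"
    using * b m r n k buf[OF k(1)] by (simp add: row_body_def base_def)
qed (use assms in \<open>simp_all add: row_body_def base_def\<close>)

lemma length_verts:
  assumes "good col"
  shows "length (verts col i j k) \<le> 3 * S"
proof -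
  have "length (verts col i j k) = card (set (verts col i j k))"
    by (rule distinct_card[symmetric]) (simp add: verts_def)
  also have "set (verts col i j k) = cls col i \<union> cls col j \<union> cls col k"
    by (auto simp: verts_def cls_def)
  also have "card \<dots> \<le> card (cls col i) + card (cls col j) + card (cls col k)"
    using card_Un_le[of "cls col i \<union> cls col j" "cls col k"] card_Un_le[of "cls col i" "cls col j"]
    by linarith
  also have "\<dots> \<le> S + S + S" using assms by (intro add_mono) (auto simp: good_def)
  finally show ?thesis by simp
qed

definition at3 :: "(nat \<Rightarrow> nat) \<Rightarrow> nat list \<Rightarrow> state \<Rightarrow> bool" where
  "at3 col xs s \<longleftrightarrow> base s \<and> regs s 23 = 2 \<and> (\<exists>buf. mem s = M col buf) \<and> out s = xs"

text \<open>Gathering passes over all \<open>n\<close> vertices; the rest depends on the at most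
  \<open>3 * S\<close> vertices found. Names and colors take 5 and 11 steps per vertex, together
  \<open>48 * S\<close>, and the product pays for the matrix.\<close>

definition instance_time :: nat where
  "instance_time = 13 * n + 48 * S + 3 * S * (3 * S * 7 + 7) + 12"

lemma wp_instance:
  assumes a: "at3 col xs s" and g: "good col"
    and r: "regs s 15 = i" "regs s 16 = j" "regs s 13 = k"
  shows "wp w instance_body (\<lambda>t s'. t \<le> instance_time \<and> at3 col (xs @ encode_inst (inst3 col i j k)) s') s"
proof -
  obtain buf0 where m0: "mem s = M col buf0" and b: "base s" and t: "regs s 23 = 2" and o: "out s = xs"
    using a by (auto simp: at3_def)
  let ?vs = "verts col i j k"
  let ?m = "length ?vs"
  have mS: "?m \<le> 3 * S" using length_verts[OF g] .
  have mn: "?m \<le> n" unfolding verts_def using length_filter_le[of _ "[0..<n]"] by simp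
  let ?s1 = "s\<lparr>regs := (regs s)(14 := 0)\<rparr>"
  have gather: "wp w (For 17 0 gather_body) (\<lambda>t s'. t \<le> n * (11 + 2) + 2 \<and>
     (\<exists>buf'. mem s' = M col buf' \<and> map buf' [0..<regs s' 14] = verts col i j k) \<and>
     frame (For 17 0 gather_body) ?s1 s') ?s1"
    by (rule wp_gather) (use b m0 r in \<open>simp_all add: base_def\<close>)
  have rest: "wp w print_body
     (\<lambda>t s''. t \<le> 48 * S + 3 * S * (3 * S * 7 + 7) + 7 \<and> at3 col (xs @ encode_inst (inst3 col i j k)) s'') s2"
    if m2: "mem s2 = M col buf" and vs: "map buf [0..<regs s2 14] = ?vs"
      and fr: "frame (For 17 0 gather_body) ?s1 s2" for s2 buf
  proof -
    note fr' = fr[unfolded frame_def, simplified]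
    have m: "regs s2 14 = ?m" using arg_cong[OF vs, of length] by simp
    have vs': "?vs = map buf [0..<?m]" using vs m by simp
    have bn: "buf a < n" if "a < ?m" for a
    proof -
      have "buf a = ?vs ! a" using that by (subst vs') simp
      also have "\<dots> \<in> set ?vs" using that by simp
      finally show ?thesis by (auto simp: verts_def)
    qed
    \<comment> \<open>Turns loops over buffer positions into maps over the vertex list. The first
      occurrence of the list, inside its length, must stay folded.\<close>
    have mapv: "map (\<lambda>a. f (buf a)) [0..<?m] = map f ?vs" for f :: "nat \<Rightarrow> nat"
      by (subst (2) vs') simp
    have mapvs: "map (\<lambda>a. f (buf a)) [0..<?m] = map f ?vs" for f :: "nat \<Rightarrow> nat list"
      by (subst (2) vs') simp
    let ?s3 = "s2\<lparr>out := xs @ [?m]\<rparr>"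
    have b3: "base ?s3" using base_frame[OF _ fr] b by (simp add: base_def)
    have names: "wp w (For 17 14 name_body) (\<lambda>t s'. t \<le> ?m * (3 + 2) + 2 \<and>
        out s' = out ?s3 @ map buf [0..<?m] \<and> frame (For 17 14 name_body) ?s3 s') ?s3"
      by (rule wp_names[OF b3]) (use m2 m mn in simp_all)
    have "wp w (For 17 14 name_body ;; For 17 14 color_body ;; For 17 14 row_body)
      (\<lambda>t s''. t \<le> (?m * (3 + 2) + 2) + ((?m * (9 + 2) + 2) + (?m * ((?m * (5 + 2) + 5) + 2) + 2)) \<and>
         at3 col (xs @ encode_inst (inst3 col i j k)) s'') ?s3"
    proof (subst wp_Seq, rule wp_conseq[OF names], elim conjE)
      fix t1 s4
      assume t1: "t1 \<le> ?m * (3 + 2) + 2" and o4: "out s4 = out ?s3 @ map buf [0..<?m]"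
        and f4: "frame (For 17 14 name_body) ?s3 s4"
      note f4' = f4[unfolded frame_def, simplified]
      have b4: "base s4" using base_frame[OF b3 f4] by simp
      have colors: "wp w (For 17 14 color_body) (\<lambda>t s'. t \<le> ?m * (9 + 2) + 2 \<and>
         out s' = out s4 @ map (\<lambda>a. tricolor col i j (buf a)) [0..<?m] \<and>
         frame (For 17 14 color_body) s4 s') s4"
        by (rule wp_colors[OF b4]) (use m2 m mn f4' bn fr' r t in simp_all)
      show "wp w (For 17 14 color_body ;; For 17 14 row_body)
        (\<lambda>u s''. t1 + u \<le> (?m * (3 + 2) + 2) + ((?m * (9 + 2) + 2) + (?m * ((?m * (5 + 2) + 5) + 2) + 2)) \<and>
         at3 col (xs @ encode_inst (inst3 col i j k)) s'') s4"
      proof (subst wp_Seq, rule wp_conseq[OF colors], elim conjE)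
        fix t2 s5
        assume t2: "t2 \<le> ?m * (9 + 2) + 2"
          and o5: "out s5 = out s4 @ map (\<lambda>a. tricolor col i j (buf a)) [0..<?m]"
          and f5: "frame (For 17 14 color_body) s4 s5"
        note f5' = f5[unfolded frame_def, simplified]
        have b5: "base s5" using base_frame[OF b4 f5] by simp
        have rows: "wp w (For 17 14 row_body) (\<lambda>t s'. t \<le> ?m * ((?m * (5 + 2) + 5) + 2) + 2 \<and>
           out s' = out s5 @ concat (map (\<lambda>a. map (\<lambda>b. bit (buf a) (buf b)) [0..<?m]) [0..<?m]) \<and>
           frame (For 17 14 row_body) s5 s') s5"
          by (rule wp_rows[OF b5]) (use m2 m mn f4' f5' bn in simp_all)
        show "wp w (For 17 14 row_body)
         (\<lambda>u s''. t1 + (t2 + u) \<le> (?m * (3 + 2) + 2) + ((?m * (9 + 2) + 2) + (?m * ((?m * (5 + 2) + 5) + 2) + 2)) \<and>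
         at3 col (xs @ encode_inst (inst3 col i j k)) s'') s5"
        proof (rule wp_conseq[OF rows], elim conjE, intro conjI)
          fix t3 s6
          assume t3: "t3 \<le> ?m * ((?m * (5 + 2) + 5) + 2) + 2"
            and o6: "out s6 = out s5 @ concat (map (\<lambda>a. map (\<lambda>b. bit (buf a) (buf b)) [0..<?m]) [0..<?m])"
            and f6: "frame (For 17 14 row_body) s5 s6"
          note f6' = f6[unfolded frame_def, simplified]
          show "t1 + (t2 + t3) \<le> (?m * (3 + 2) + 2) + ((?m * (9 + 2) + 2) + (?m * ((?m * (5 + 2) + 5) + 2) + 2))"
            using t1 t2 t3 by (intro add_mono)
          have b6: "base s6" using base_frame[OF b5 f6] by simp
          have "out s6 = xs @ [?m] @ ?vs @ map (tricolor col i j) ?vs @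
              concat (map (\<lambda>x. map (\<lambda>y. bit x y) ?vs) ?vs)"
            unfolding o6 o5 o4 mapvs[of "\<lambda>x. map (bit x) ?vs"]
              mapv[of "bit _"] mapv[of "tricolor col i j"] vs'[symmetric] by simp
          also have "\<dots> = xs @ encode_inst (inst3 col i j k)"
          proof -
            \<comment> \<open>The program prints adjacency in \<open>E\<close>, which on the listed
              vertices is adjacency in the induced subgraph.\<close>
            have "{x, y} \<in> induced_edges E (set ?vs) \<longleftrightarrow> {x, y} \<in> E" if "x \<in> set ?vs" "y \<in> set ?vs" for x y
              using that by (simp add: induced_edges_def)
            then have "map (\<lambda>x. map (\<lambda>y. bit x y) ?vs) ?vs =
                map (\<lambda>x. map (\<lambda>y. if {x, y} \<in> induced_edges E (set ?vs) then 1 else 0) ?vs) ?vs"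
              by (intro map_cong refl) simp
            then show ?thesis by (simp add: encode_inst_def inst3_def Let_def del: map_eq_conv)
          qed
          finally show "at3 col (xs @ encode_inst (inst3 col i j k)) s6"
            using b6 t m2 fr' f4' f5' f6' by (auto simp: at3_def)
        qed
      qed
    qed
    then have *: "wp w (For 17 14 name_body ;; For 17 14 color_body ;; For 17 14 row_body)
      (\<lambda>t s''. 1 + t \<le> 48 * S + 3 * S * (3 * S * 7 + 7) + 7 \<and>
         at3 col (xs @ encode_inst (inst3 col i j k)) s'') ?s3"
    proof (rule wp_conseq, elim conjE, intro conjI)
      fix t assume "t \<le> (?m * (3 + 2) + 2) + ((?m * (9 + 2) + 2) + (?m * ((?m * (5 + 2) + 5) + 2) + 2))"
      also have "?m * ((?m * (5 + 2) + 5) + 2) \<le> 3 * S * (3 * S * 7 + 7)"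
        using mS by (intro mult_mono) auto
      finally show "1 + t \<le> 48 * S + 3 * S * (3 * S * 7 + 7) + 7"
        using mS by simp
    qed
    show ?thesis
      unfolding print_body_def using * o fr' m by (subst wp_Seq) (simp del: wp_Seq)
  qed
  have "wp w (For 17 0 gather_body)
    (\<lambda>t. wp w print_body
     (\<lambda>u s''. 1 + (t + u) \<le> instance_time \<and> at3 col (xs @ encode_inst (inst3 col i j k)) s'')) ?s1"
    apply (rule wp_conseq[OF gather])
    apply (elim conjE exE)
    subgoal for t s2 buf by (rule wp_conseq[OF rest[of s2 buf]]) (auto simp: instance_time_def)
    done
  then show ?thesis
    by (simp add: instance_body_def)
qed


lemma wp_phase3:
  assumes a: "at3 col xs s" and g: "good col"
  defines "K \<equiv> 2 * S + 1"
  shows "wp w phase3 (\<lambda>t s'. t \<le> K * ((K * ((K * (instance_time + 2) + 2) + 2) + 2) + 2) + 2 \<and>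
     out s' = xs @ concat (map (\<lambda>i. concat (map (\<lambda>j. concat (map (\<lambda>k. encode_inst (inst3 col i j k))
       [0..<j])) [0..<i])) [0..<K])) s"
proof -
  let ?e = "\<lambda>i j k. encode_inst (inst3 col i j k)"
  let ?e2 = "\<lambda>i j. concat (map (?e i j) [0..<j])"
  let ?e1 = "\<lambda>i. concat (map (?e2 i) [0..<i])"
  have indep: "at3 col ys (s'\<lparr>regs := (regs s')(i := x)\<rparr>)" if "at3 col ys s'" "i \<in> {13, 15, 16}" for ys s' i x
    using that by (auto simp: at3_def base_def)
  have "wp w phase3 (\<lambda>t s'. t \<le> K * ((K * ((K * (instance_time + 2) + 2) + 2) + 2) + 2) + 2 \<and>
     at3 col (xs @ concat (map ?e1 [0..<K])) s' \<and> frame phase3 s s') s"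
    unfolding phase3_def
  proof (rule wp_For[where Inv = "\<lambda>i. at3 col (xs @ concat (map ?e1 [0..<i]))"])
    fix i s1
    let ?xs = "xs @ concat (map ?e1 [0..<i])"
    assume i: "i < K" "regs s1 15 = i" and a1: "at3 col ?xs s1"
    have "wp w (For 16 15 (For 13 16 instance_body)) (\<lambda>t s'. t \<le> i * ((K * (instance_time + 2) + 2) + 2) + 2 \<and>
        at3 col (?xs @ ?e1 i) s' \<and> frame (For 16 15 (For 13 16 instance_body)) s1 s') s1"
    proof (rule wp_For[where Inv = "\<lambda>j. at3 col (?xs @ concat (map (?e2 i) [0..<j]))"])
      fix j s2
      let ?ys = "?xs @ concat (map (?e2 i) [0..<j])"
      assume j: "j < i" "regs s2 16 = j" and a2: "at3 col ?ys s2"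
        and f2: "frame (For 16 15 (For 13 16 instance_body)) s1 s2"
      have i2: "regs s2 15 = i" using f2 i by (simp add: frame_def)
      have "wp w (For 13 16 instance_body) (\<lambda>t s'. t \<le> j * (instance_time + 2) + 2 \<and>
          at3 col (?ys @ concat (map (?e i j) [0..<j])) s' \<and> frame (For 13 16 instance_body) s2 s') s2"
      proof (rule wp_For[where Inv = "\<lambda>k. at3 col (?ys @ concat (map (?e i j) [0..<k]))"])
        fix k s3
        assume k: "k < j" "regs s3 13 = k" and a3: "at3 col (?ys @ concat (map (?e i j) [0..<k])) s3"
          and f3: "frame (For 13 16 instance_body) s2 s3"
        have "regs s3 15 = i" "regs s3 16 = j" using f3 i2 j by (simp_all add: frame_def)
        from wp_instance[OF a3 g this k(2)]
        show "wp w instance_body (\<lambda>t s''. t \<le> instance_time \<and> at3 col (?ys @ concat (map (?e i j) [0..<Suc k])) s'') s3"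
          by simp
      next
        show "j < 2 ^ w" using i j S_le by (simp add: K_def)
      qed (use a2 j indep in \<open>simp_all add: at3_def base_def\<close>)
      \<comment> \<open>The inner loops have varying lengths, while \<open>wp_For\<close> asks for
        one bound on all rounds, so each length is raised to \<open>K\<close>.\<close>
      moreover have "j * (instance_time + 2) + 2 \<le> K * (instance_time + 2) + 2"
        using i j by (intro add_right_mono mult_right_mono) auto
      ultimately show "wp w (For 13 16 instance_body) (\<lambda>t s''. t \<le> K * (instance_time + 2) + 2 \<and>
          at3 col (?xs @ concat (map (?e2 i) [0..<Suc j])) s'') s2"
        by (elim wp_conseq) (use le_trans in auto)
    next
      show "i < 2 ^ w" using i S_le by (simp add: K_def)
    qed (use a1 i indep in \<open>simp_all add: at3_def base_def\<close>)
    moreover have "i * ((K * (instance_time + 2) + 2) + 2) + 2 \<le> K * ((K * (instance_time + 2) + 2) + 2) + 2"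
      using i by (intro add_right_mono mult_right_mono) auto
    ultimately show "wp w (For 16 15 (For 13 16 instance_body))
       (\<lambda>t s''. t \<le> K * ((K * (instance_time + 2) + 2) + 2) + 2 \<and> at3 col (xs @ concat (map ?e1 [0..<Suc i])) s'') s1"
      by (elim wp_conseq) (use le_trans in auto)
  next
    show "K < 2 ^ w" using S_le by (simp add: K_def)
  qed (use a indep in \<open>simp_all add: at3_def base_def K_def\<close>)
  then show ?thesis by (rule wp_conseq) (simp add: at3_def)
qed

section \<open>Each triangle lies in exactly one triple of classes\<close>

definition triples :: "nat \<Rightarrow> (nat \<times> nat \<times> nat) list" where
  "triples K = concat (map (\<lambda>i. concat (map (\<lambda>j. map (\<lambda>k. (i, j, k)) [0..<j]) [0..<i])) [0..<K])"

definition insts :: "(nat \<Rightarrow> nat) \<Rightarrow> inst list" where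
  "insts col = map (\<lambda>(i, j, k). inst3 col i j k) (triples (2 * S + 1))"

lemma concat_map_concat_map:
  "concat (map f (concat (map g xs))) = concat (map (\<lambda>x. concat (map f (g x))) xs)"
  by (induction xs) auto

lemma encode_insts:
  "concat (map encode_inst (insts col)) = concat (map (\<lambda>i. concat (map (\<lambda>j.
     concat (map (\<lambda>k. encode_inst (inst3 col i j k)) [0..<j])) [0..<i])) [0..<2 * S + 1])"
  by (simp add: insts_def triples_def concat_map_concat_map comp_def del: upt_Suc)

lemma set_triples: "set (triples K) = {(i, j, k). k < j \<and> j < i \<and> i < K}"
  by (auto simp: triples_def image_iff)

lemma distinct_concat_map:
  assumes "distinct xs" "\<And>x. x \<in> set xs \<Longrightarrow> distinct (f x)"
    "\<And>x y. x \<in> set xs \<Longrightarrow> y \<in> set xs \<Longrightarrow> x \<noteq> y \<Longrightarrow> set (f x) \<inter> set (f y) = {}"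
  shows "distinct (concat (map f xs))"
  using assms
proof (induction xs)
  case (Cons a xs)
  have "set (f a) \<inter> set (f y) = {}" if "y \<in> set xs" for y
    using Cons.prems(1) that by (intro Cons.prems(3)) auto
  moreover have "distinct (concat (map f xs))"
    using Cons.prems by (intro Cons.IH) simp_all
  ultimately show ?case using Cons.prems(2)[of a] by auto
qed simp

text \<open>Uniqueness is argued on index triples because the instances themselves can coincide, for
  example when the smallest colors of two triples both have empty classes.\<close>

lemma distinct_triples: "distinct (triples K)"
  unfolding triples_def
  by (intro distinct_concat_map) (auto simp: distinct_map inj_on_def)

lemma length_triples: "length (triples K) \<le> K ^ 3"
proof -
  have "length (triples K) = card (set (triples K))"
    by (rule distinct_card[symmetric, OF distinct_triples])
  also have "\<dots> \<le> card ({..<K} \<times> {..<K} \<times> {..<K})"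
    by (intro card_mono) (auto simp: set_triples)
  finally show ?thesis by (simp add: power3_eq_cube algebra_simps)
qed

lemma inst3_correct:
  assumes "good col"
  shows "colored_induced_inst {..<n} E (inst3 col i j k)"
proof -
  have "tricolor col i j u \<noteq> tricolor col i j v"
    if "u \<in> set (verts col i j k)" "v \<in> set (verts col i j k)" "{u, v} \<in> E" for u v
  proof -
    have "col u \<noteq> col v" using assms that edge[OF that(3)] by (fastforce simp: good_def indep_def)
    then show ?thesis using that by (auto simp: verts_def tricolor_def)
  qed
  then show ?thesis
    by (auto simp: colored_induced_inst_def inst3_def verts_def proper_3_coloring_def induced_edges_def
      tricolor_def)
qed

lemma triangle_inst3:
  assumes "triangle {..<n} E T"
  shows "triangle (set (ivertices (inst3 col i j k))) (iedges (inst3 col i j k)) T \<longleftrightarrow> col ` T \<subseteq> {i, j, k}"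
  using assms by (auto simp: triangle_def inst3_def verts_def induced_edges_def)

text \<open>Three elements inside \<open>{i, j, k}\<close> exhaust it, and a set has only one
  decreasing listing.\<close>

lemma ex1_ordered_triple:
  fixes A :: "nat set"
  assumes "card A = 3"
  shows "\<exists>!t. case t of (i, j, k) \<Rightarrow> k < j \<and> j < i \<and> A \<subseteq> {i, j, k}"
proof -
  obtain a b c where A: "A = {a, b, c}" and d: "a \<noteq> b" "a \<noteq> c" "b \<noteq> c"
    using assms by (auto simp: card_3_iff)
  have "\<exists>i j k. k < j \<and> j < i \<and> A \<subseteq> {i, j, k}"
  proof -
    consider "c < b" "b < a" | "b < c" "c < a" | "c < a" "a < b" | "a < c" "c < b" | "a < b" "b < c" | "b < a" "a < c"
      using d by linarith
    then show ?thesis unfolding A by cases blast+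
  qed
  then obtain i j k where 1: "k < j" "j < i" "A \<subseteq> {i, j, k}" by blast
  show ?thesis
  proof (rule ex1I[of _ "(i, j, k)"])
    fix t assume t: "case t of (i, j, k) \<Rightarrow> k < j \<and> j < i \<and> A \<subseteq> {i, j, k}"
    obtain i' j' k' where t': "t = (i', j', k')" by (cases t)
    show "t = (i, j, k)" using t 1 d unfolding t' A by auto
  qed (use 1 in simp)
qed

lemma insts_correct:
  assumes g: "good col" and num: "real ((2 * S + 1) ^ 3) \<le> N" and size: "real (3 * S) \<le> L"
  shows "correct_answer {..<n} E N L (Instances (insts col))"
proof -
  have len: "length (insts col) \<le> (2 * S + 1) ^ 3"
    using length_triples[of "2 * S + 1"] by (simp add: insts_def)
  have all: "colored_induced_inst {..<n} E I \<and> real (length (ivertices I)) \<le> L" if I: "I \<in> set (insts col)" for I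
  proof -
    obtain i j k where "I = inst3 col i j k" using I by (auto simp: insts_def)
    then show ?thesis using inst3_correct[OF g] length_verts[OF g, of i j k] size
      by (simp add: inst3_def)
  qed
  have ex1: "\<exists>!p. p < length (insts col) \<and>
      triangle (set (ivertices (insts col ! p))) (iedges (insts col ! p)) T"
    if T: "triangle {..<n} E T" for T
  proof -
    let ?Q = "\<lambda>t. case t of (i, j, k) \<Rightarrow> k < j \<and> j < i \<and> col ` T \<subseteq> {i, j, k}"
    let ?ts = "triples (2 * S + 1)"
    \<comment> \<open>Adjacent corners of equal color would both have color 0, which
      \<open>good\<close> excludes.\<close>
    have "inj_on col T"
    proof (rule inj_onI, rule ccontr)
      fix x y assume xy: "x \<in> T" "y \<in> T" "col x = col y" "x \<noteq> y"
      then have "{x, y} \<in> E" using T by (auto simp: triangle_def)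
      then show False using xy g edge[of x y] by (fastforce simp: good_def indep_def)
    qed
    then have c3: "card (col ` T) = 3" using T by (simp add: card_image triangle_def)
    obtain i j k where t: "?Q (i, j, k)" and uniq: "\<And>t. ?Q t \<Longrightarrow> t = (i, j, k)"
      using ex1_ordered_triple[OF c3] by (metis (no_types, lifting) prod_cases3)
    have "card {i, j, k} \<le> card (col ` T)" using c3 t by (auto simp: card_insert_if)
    \<comment> \<open>Equality shows that \<open>i\<close> is the color of a corner and hence within
      the range of the triples.\<close>
    then have "col ` T = {i, j, k}" using t by (intro card_seteq) auto
    then have "i \<in> col ` T" by simp
    then obtain x where "x \<in> T" "col x = i" by (rule imageE) simp
    then have "i < 2 * S + 1" using T g by (fastforce simp: triangle_def good_def)
    then have "(i, j, k) \<in> set ?ts" using t by (simp add: set_triples)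
    then obtain p where p: "p < length ?ts" "?ts ! p = (i, j, k)" by (auto simp: in_set_conv_nth)
    have "triangle (set (ivertices (insts col ! q))) (iedges (insts col ! q)) T \<longleftrightarrow> q = p"
      if q: "q < length ?ts" for q
    proof -
      obtain a b c where abc: "?ts ! q = (a, b, c)" by (cases "?ts ! q")
      then have "(a, b, c) \<in> set ?ts" using q by (metis nth_mem)
      then have "col ` T \<subseteq> {a, b, c} \<longleftrightarrow> (a, b, c) = (i, j, k)"
        using uniq[of "(a, b, c)"] t by (auto simp: set_triples)
      also have "\<dots> \<longleftrightarrow> q = p"
        using abc p q distinct_triples[of "2 * S + 1"] by (metis nth_eq_iff_index_eq)
      finally show ?thesis using q abc triangle_inst3[OF T, of col a b c] by (simp add: insts_def)
    qed
    moreover have "length (insts col) = length ?ts" by (simp add: insts_def)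
    ultimately show ?thesis using p by (intro ex1I[of _ p]) auto
  qed
  show ?thesis
    unfolding correct_answer.simps
  proof (intro conjI)
    show "real (length (insts col)) \<le> N"
      using num by (rule order_trans[OF of_nat_mono[OF len]])
  qed (use all ex1 in blast)+
qed


section \<open>Composition of the phases\<close>

definition coloring_time :: nat where
  "coloring_time = (n * ((n * ((18 * S + 30) + 2) + 3) + 2) + 2) +
     (n * (((2 * S + 1) * ((12 * n + 15) + 2) + 2) + 2) + 2)"

definition output_time :: nat where
  "output_time = (2 * S + 1) * (((2 * S + 1) * (((2 * S + 1) * (instance_time + 2) + 2) + 2) + 2) + 2) + 2"

lemma wp_main:
  assumes "base s" "mem s = M (\<lambda>_. 0) (\<lambda>_. 0)" "out s = []" "regs s 9 = 0" "regs s 13 = 1"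
    and num: "real ((2 * S + 1) ^ 3) \<le> N" and size: "real (3 * S) \<le> L"
  shows "wp w (phase1 ;; phase2 ;;
     IfPos 9 (Emit 8 ;; Emit 10 ;; Emit 11 ;; Emit 12) (Emit 2 ;; Const 23 2 ;; phase3))
    (\<lambda>t s'. t \<le> coloring_time + output_time + 5 \<and>
       (\<exists>A. out s' = encode_answer A \<and> correct_answer {..<n} E N L A)) s"
proof -
  let ?out = "IfPos 9 (Emit 8 ;; Emit 10 ;; Emit 11 ;; Emit 12) (Emit 2 ;; Const 23 2 ;; phase3)"
  let ?Q = "\<lambda>s'. \<exists>A. out s' = encode_answer A \<and> correct_answer {..<n} E N L A"
  have out: "wp w ?out (\<lambda>t s'. t \<le> output_time + 5 \<and> ?Q s') s2" if "after2 n s2" for s2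
  proof -
    obtain col buf where m: "mem s2 = M col buf" "inv2 col (regs s2 9)" "\<forall>v<n. col v \<noteq> 0"
      and b: "base s2" "out s2 = []" "flag_ok s2"
      using \<open>after2 n s2\<close> unfolding after2_def by (elim conjE exE) (rule that)
    show ?thesis
    proof (cases "regs s2 9 = 0")
      case False
      then have "correct_answer {..<n} E N L (Triangle (regs s2 10) (regs s2 11) (regs s2 12))"
        using b by (simp add: flag_ok_def)
      then have "\<exists>A. [0, regs s2 10, regs s2 11, regs s2 12] = encode_answer A \<and> correct_answer {..<n} E N L A"
        by (metis encode_answer.simps(1))
      then show ?thesis using False b by (simp add: base_def)
    next
      case True
      then have g: "good col" using inv2_imp_good m by simp
      let ?s3 = "s2\<lparr>out := [1], regs := (regs s2)(23 := 2)\<rparr>"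
      have "at3 col [1] ?s3" using b m by (auto simp: at3_def base_def)
      note p3 = wp_phase3[OF this g]
      have "wp w phase3 (\<lambda>t s'. 3 + t \<le> output_time + 5 \<and> ?Q s') ?s3"
      proof (rule wp_conseq[OF p3], elim conjE, intro conjI)
        fix t s' assume "t \<le> (2 * S + 1) * (((2 * S + 1) * (((2 * S + 1) * (instance_time + 2) + 2) + 2) + 2) + 2) + 2"
        then show "3 + t \<le> output_time + 5" by (simp add: output_time_def)
        assume "out s' = [1] @ concat (map (\<lambda>i. concat (map (\<lambda>j.
           concat (map (\<lambda>k. encode_inst (inst3 col i j k)) [0..<j])) [0..<i])) [0..<2 * S + 1])"
        then have "out s' = encode_answer (Instances (insts col))"
          by (simp only: encode_insts[symmetric]) simp
        then show "?Q s'" using insts_correct[OF g num size] by blast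
      qed
      moreover have "2 mod 2 ^ w = (2 :: nat)" by simp
      ultimately show ?thesis using True b by (simp add: base_def del: mod_word)
    qed
  qed
  show ?thesis
  proof (subst wp_Seq, rule wp_conseq[OF wp_phase1[OF assms(1-5)]], elim conjE)
    fix t1 s1
    assume 1: "t1 \<le> n * ((n * ((18 * S + 30) + 2) + 3) + 2) + 2" "after1 n s1"
    show "wp w (phase2 ;; ?out) (\<lambda>u s'. t1 + u \<le> coloring_time + output_time + 5 \<and> ?Q s') s1"
    proof (subst wp_Seq, rule wp_conseq[OF wp_phase2[OF 1(2)]], elim conjE)
      fix t2 s2
      assume 2: "t2 \<le> n * (((2 * S + 1) * ((12 * n + 15) + 2) + 2) + 2) + 2" "after2 n s2"
      show "wp w ?out (\<lambda>u s'. t1 + (t2 + u) \<le> coloring_time + output_time + 5 \<and> ?Q s') s2"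
      proof (rule wp_conseq[OF out[OF 2(2)]], elim conjE, intro conjI)
        fix t assume "t \<le> output_time + 5"
        with 1(1) 2(1) show "t1 + (t2 + t) \<le> coloring_time + output_time + 5" unfolding coloring_time_def by linarith
      qed
    qed
  qed
qed

end

section \<open>Running time\<close>

text \<open>Stated over the reals so that monotonicity can replace the integer \<open>S\<close> by
  sqrt n + 1.\<close>

definition time_bound :: "real \<Rightarrow> real \<Rightarrow> real" where
  "time_bound n S = 5 * n +
     ((n * ((n * ((18 * S + 30) + 2) + 3) + 2) + 2) +
     (n * (((2 * S + 1) * ((12 * n + 15) + 2) + 2) + 2) + 2)) +
     ((2 * S + 1) * (((2 * S + 1) * (((2 * S + 1) *
        ((13 * n + 48 * S + 3 * S * (3 * S * 7 + 7) + 12) + 2) + 2) + 2) + 2) + 2) + 2) + 13"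

lemma time_bound_mono: "0 \<le> n \<Longrightarrow> 0 \<le> S \<Longrightarrow> S \<le> S' \<Longrightarrow> time_bound n S \<le> time_bound n S'"
  unfolding time_bound_def by (intro add_mono mult_mono order_refl) auto

text \<open>The fourth power dominates for every \<open>n\<close>; the cube fails at
  \<open>n = 0\<close>, where 8 < 10.\<close>

lemma word_size:
  assumes "4 * log 2 (real n + 2) \<le> real w"
  shows "n * n + 10 * n + 10 < 2 ^ w"
proof -
  have "(real n + 2) ^ 4 = 2 powr (log 2 ((real n + 2) ^ 4))" by simp
  also have "log 2 ((real n + 2) ^ 4) = 4 * log 2 (real n + 2)" by (simp add: log_nat_power)
  also have "2 powr (4 * log 2 (real n + 2)) \<le> 2 powr real w" using assms by simp
  finally have "real ((n + 2) ^ 4) \<le> real (2 ^ w)" by (simp add: powr_realpow add.commute)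
  then have "(n + 2) ^ 4 \<le> 2 ^ w" by (simp only: of_nat_le_iff)
  moreover have "n * n + 10 * n + 10 < (n + 2) ^ 4"
    by (simp add: eval_nat_numeral algebra_simps)
  ultimately show ?thesis by simp
qed

lemma prog_correct:
  assumes g: "simple_graph {..<n} E" and w: "4 * log 2 (real n + 2) \<le> real w"
  shows "\<exists>t s A. exec w prog (init_state n E) t s \<and> real t \<le> time_bound (real n) (sqrt (real n) + 1) \<and>
     out s = encode_answer A \<and>
     correct_answer {..<n} E ((2 * (sqrt (real n) + 1) + 1) ^ 3) (3 * (sqrt (real n) + 1)) A"
proof -
  let ?N = "(2 * (sqrt (real n) + 1) + 1) ^ 3" and ?L = "3 * (sqrt (real n) + 1)"
  let ?Q = "\<lambda>t s. real t \<le> time_bound (real n) (sqrt (real n) + 1) \<and>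
     (\<exists>A. out s = encode_answer A \<and> correct_answer {..<n} E ?N ?L A)"
  note word = word_size[OF w]
  have small: "a mod 2 ^ w = a" if "a \<le> n * n + 10 * n + 10" for a
    using word that by simp
  let ?s0 = "(init_state n E)\<lparr>regs := (regs (init_state n E))(2 := 1, 4 := n * n)\<rparr>"
  define tail where "tail = phase1 ;; phase2 ;;
     IfPos 9 (Emit 8 ;; Emit 10 ;; Emit 11 ;; Emit 12) (Emit 2 ;; Const 23 2 ;; phase3)"
  have root: "wp w (For 15 0 root_body) (\<lambda>t s'. t \<le> n * (3 + 2) + 2 \<and>
     (regs s' 3 \<le> n \<and> (n \<le> regs s' 3 * regs s' 3 \<or> regs s' 3 = n) \<and>
      (regs s' 3 = 0 \<or> (regs s' 3 - 1) * (regs s' 3 - 1) < n)) \<and>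
     frame (For 15 0 root_body) ?s0 s') ?s0"
    by (rule wp_root) (use word in \<open>simp_all add: init_state_def\<close>)
  have rest: "wp w (Add 5 4 0 ;; Add 7 3 3 ;; Add 7 7 2 ;; Const 13 1 ;; tail)
      (\<lambda>u. ?Q (2 + (t + u))) s1"
    if t: "t \<le> n * (3 + 2) + 2" and S1: "regs s1 3 \<le> n" "n \<le> regs s1 3 * regs s1 3 \<or> regs s1 3 = n"
      "regs s1 3 = 0 \<or> (regs s1 3 - 1) * (regs s1 3 - 1) < n"
      and fr: "frame (For 15 0 root_body) ?s0 s1" for t s1
  proof -
    define S where "S = regs s1 3"
    note fr' = fr[unfolded frame_def root_body_def, simplified]
    have S: "S \<le> n" "n \<le> S * S" using S1 le_square[of n] by (auto simp: S_def)
    interpret ram w n S E using g word S by unfold_locales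
    \<comment> \<open>The search stopped as early as possible, so \<open>S - 1\<close> is still
      below the root and rounding up costs at most 1.\<close>
    have Sr: "real S \<le> sqrt (real n) + 1"
    proof (cases "S = 0")
      case False
      then have "(S - 1) * (S - 1) < n" using S1(3) by (simp add: S_def)
      then have "real (S - 1) ^ 2 \<le> real n" by (simp add: power2_eq_square flip: of_nat_mult)
      then have "real (S - 1) \<le> sqrt (real n)" by (rule real_le_rsqrt)
      then show ?thesis using False by (simp add: of_nat_diff)
    qed simp
    let ?s2 = "s1\<lparr>regs := (regs s1)(5 := n * n + n, 7 := Suc (S + S), 13 := 1)\<rparr>"
    have num: "real ((2 * S + 1) ^ 3) \<le> ?N"
      using Sr by (simp del: of_nat_add of_nat_mult)
    have size: "real (3 * S) \<le> ?L" using Sr by simp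
    have m: "mem ?s2 = M (\<lambda>_. 0) (\<lambda>_. 0)"
      using fr' by (auto simp: init_state_def M_def fun_eq_iff)
    have "wp w tail (\<lambda>t s'. t \<le> coloring_time + output_time + 5 \<and>
       (\<exists>A. out s' = encode_answer A \<and> correct_answer {..<n} E ?N ?L A)) ?s2"
      by (rule wp_main[folded tail_def, OF _ m _ _ _ num size])
        (use fr' in \<open>simp_all add: base_def init_state_def S_def[symmetric]\<close>)
    then have "wp w tail (\<lambda>u. ?Q (2 + (t + (4 + u)))) ?s2"
    proof (rule wp_conseq, elim conjE, intro conjI)
      fix u assume "u \<le> coloring_time + output_time + 5"
      \<comment> \<open>The constant 13 is 2 steps before the root search, 2 in it, 4 after it and 5
        around the output.\<close>
      then have "2 + (t + (4 + u)) \<le> 5 * n + coloring_time + output_time + 13" using t by simp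
      then have "real (2 + (t + (4 + u))) \<le> real (5 * n + coloring_time + output_time + 13)" by (simp only: of_nat_le_iff)
      also have "\<dots> \<le> time_bound (real n) (real S)"
        by (simp only: time_bound_def coloring_time_def output_time_def instance_time_def of_nat_add of_nat_mult of_nat_numeral of_nat_1
          order_refl)
      also have "\<dots> \<le> time_bound (real n) (sqrt (real n) + 1)"
        using Sr by (intro time_bound_mono) auto
      finally show "real (2 + (t + (4 + u))) \<le> time_bound (real n) (sqrt (real n) + 1)" .
    qed
    moreover have "regs s1 0 = n" "regs s1 2 = 1" "regs s1 4 = n * n" "regs s1 3 = S"
      using fr' by (simp_all add: init_state_def S_def)
    ultimately show ?thesis
      using S_le by simp
  qed
  have "wp w (For 15 0 root_body)
      (\<lambda>t. wp w (Add 5 4 0 ;; Add 7 3 3 ;; Add 7 7 2 ;; Const 13 1 ;; tail) (\<lambda>u. ?Q (2 + (t + u)))) ?s0"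
    by (rule wp_conseq[OF root], elim conjE, rule rest)
  moreover have "0 < w" using word by (cases w) auto
  ultimately have "wp w prog ?Q (init_state n E)"
    unfolding prog_def tail_def[symmetric] using small[of "n * n"] by (simp add: init_state_def)
  then show ?thesis unfolding wp_def by blast
qed

lemma time_bound_bigo:
  "(\<lambda>n. time_bound (real n) (sqrt (real n) + 1)) \<in> O(\<lambda>n. real n powr (5 / 2))"
  unfolding time_bound_def by real_asymp

theorem theorem1p5:
  "\<exists>(P :: com) (c :: real) (time :: nat \<Rightarrow> real) (num :: nat \<Rightarrow> real) (size :: nat \<Rightarrow> real).
     time \<in> O(\<lambda>n. real n powr (5 / 2)) \<and>
     num \<in> O(\<lambda>n. real n powr (3 / 2)) \<and>
     size \<in> O(\<lambda>n. sqrt (real n)) \<and>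
     (\<forall>(n :: nat) (E :: nat set set) (w :: nat).
        simple_graph {..<n} E \<longrightarrow> c * log 2 (real n + 2) \<le> real w \<longrightarrow>
        (\<exists>t s A. exec w P (init_state n E) t s \<and> real t \<le> time n \<and>
           out s = encode_answer A \<and> correct_answer {..<n} E (num n) (size n) A))"
proof -
  let ?time = "\<lambda>n. time_bound (real n) (sqrt (real n) + 1)"
  let ?num = "\<lambda>n. (2 * (sqrt (real n) + 1) + 1) ^ 3"
  let ?size = "\<lambda>n. 3 * (sqrt (real n) + 1)"
  have "?time \<in> O(\<lambda>n. real n powr (5 / 2))" by (rule time_bound_bigo)
  moreover have "?num \<in> O(\<lambda>n. real n powr (3 / 2))" by real_asymp
  moreover have "?size \<in> O(\<lambda>n. sqrt (real n))" by real_asymp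
  ultimately show ?thesis
    using prog_correct
    by (intro exI[of _ prog] exI[of _ 4] exI[of _ ?time] exI[of _ ?num] exI[of _ ?size]) blast
qed

end
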